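(* Let $\mathcal{H}$ be a real Hilbert space, let $S:\mathcal{H}\to 2^{\mathcal{H}}$ be maximal monotone, let $T:\mathcal{H}\to\mathcal{H}$ be monotone and Lipschitz continuous with constant $\mathsf{L}>0$, and assume that $(S+T)^{-1}(0)$ is nonempty. Let $\delta_0,\delta_1>0$, $\bar{\beta}\in(0,\frac14)$, $\bar{r}\in\left(\bar{\beta},\frac{1-2\bar{\beta}}{2}\right)$, let $\{\sigma_n\}_{n\ge1}$ be a sequence in $(0,1)$, $\{c_n\}_{n\ge1}$ a sequence in $[0,\infty)$ with $\sum_{n=1}^\infty c_n<\infty$, and $\{\vartheta_n\}_{n\ge1}$ a sequence of real numbers. For arbitrary $\hat{v},w_0,w_1\in\mathcal{H}$, let $\{w_n\}$ be generated by $$w_{n+1}=J^{S}_{\delta_n}\big(\sigma_n\hat{v}+(1-\sigma_n)(w_n+\vartheta_n(w_n-w_{n-1}))-\delta_nTw_n-\delta_{n-1}(1-\sigma_n)(Tw_n-Tw_{n-1})\big),\quad n\ge1,$$ where, for $n\ge 1$, $$\delta_{n+1}=\begin{cases}\min\left\{\dfrac{\bar{r}\|w_n-w_{n+1}\|}{\|Tw_n-Tw_{n+1}\|},\ \delta_n+c_n\right\},&\text{if }Tw_n\ne Tw_{n+1},\\ \delta_n+c_n,&\text{otherwise.}\end{cases}$$ If there is a real number $\bar{\vartheta}$ such that $0\le\vartheta_n\le\vartheta_{n+1}\le\bar{\vartheta}<\min\left\{\frac{\bar{\beta}}{2},\frac{\frac12-\bar{r}}{2}\right\}$ for all $n\ge1$,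 and if $\lim_{n\to\infty}\sigma_n=0$ and $\sum_{n=1}^\infty\sigma_n=\infty$, then $\{w_n\}$ converges strongly (i.e., in norm) to $P_{(S+T)^{-1}(0)}\hat{v}$.
   Context: $(S+T)^{-1}(0)=\{w\in\mathcal{H}: 0\in Sw+Tw\}$. For $\delta>0$, $J^S_\delta=(I_{\mathcal{H}}+\delta S)^{-1}$ is the resolvent of $S$, which is single-valued and everywhere defined when $S$ is maximal monotone. A set-valued operator $S$ is monotone if $\langle \hat a-\hat b,a-b\rangle\ge0$ for all $a,b\in\mathcal{H}$, $\hat a\in Sa$, $\hat b\in Sb$, and maximal monotone if, in addition, its graph is not properly contained in the graph of any other monotone operator. $T$ is monotone if $\langle Ta-Tb,a-b\rangle\ge0$ for all $a,b$, and Lipschitz continuous with constant $\mathsf{L}$ if $\|Ta-Tb\|\le\mathsf{L}\|a-b\|$ for all $a,b$. $P_C$ denotes the metric projection onto a nonempty closed convex set $C\subseteq\mathcal{H}$ (the set $(S+T)^{-1}(0)$ is closed and convex because $S+T$ is maximal monotone). *)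

theory Defs
  imports "HOL-Analysis.Analysis"
begin

text \<open>Set-valued operators on a real Hilbert space are functions into sets; their graph is
  the set of pairs \<open>(a, a')\<close> with \<open>a' \<in> A a\<close>.\<close>

definition op_graph :: "('a \<Rightarrow> 'a set) \<Rightarrow> ('a \<times> 'a) set" where
  "op_graph A = {(a, a'). a' \<in> A a}"

definition monotone_operator :: "('a::real_inner \<Rightarrow> 'a set) \<Rightarrow> bool" where
  "monotone_operator A \<longleftrightarrow>
     (\<forall>a b. \<forall>a'\<in>A a. \<forall>b'\<in>A b. inner (a' - b') (a - b) \<ge> 0)"

definition maximal_monotone :: "('a::real_inner \<Rightarrow> 'a set) \<Rightarrow> bool" where
  "maximal_monotone A \<longleftrightarrow>
     monotone_operator A \<and> (\<forall>B. monotone_operator B \<longrightarrow> \<not> op_graph A \<subset> op_graph B)"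

definition op_inverse :: "('a \<Rightarrow> 'a set) \<Rightarrow> 'a \<Rightarrow> 'a set" where
  "op_inverse A y = {x. y \<in> A x}"

definition op_sum :: "('a::plus \<Rightarrow> 'a set) \<Rightarrow> ('a \<Rightarrow> 'a) \<Rightarrow> 'a \<Rightarrow> 'a set" where
  "op_sum S T x = {u + T x | u. u \<in> S x}"

text \<open>The resolvent \<open>(I + \<delta> S)\<^sup>-\<^sup>1\<close> as a point-valued map. The description operator is
  meaningful when that inverse is single-valued and everywhere defined, which is the case
  for maximal monotone \<open>S\<close> and \<open>\<delta> > 0\<close> on a Hilbert space.\<close>

definition resolvent :: "real \<Rightarrow> ('a::real_vector \<Rightarrow> 'a set) \<Rightarrow> 'a \<Rightarrow> 'a" where
  "resolvent \<delta> S y = (THE x. x \<in> op_inverse (\<lambda>z. {z + \<delta> *\<^sub>R u | u. u \<in> S z}) y)"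

text \<open>The library's \<^const>\<open>closest_point\<close> requires the class \<^class>\<open>heine_borel\<close>, which
  excludes infinite-dimensional spaces. Existence and uniqueness of the nearest point hold
  for nonempty closed convex \<open>C\<close> in a Hilbert space.\<close>

definition metric_projection :: "'a::metric_space set \<Rightarrow> 'a \<Rightarrow> 'a" where
  "metric_projection C x = (THE p. p \<in> C \<and> (\<forall>y\<in>C. dist x p \<le> dist x y))"

end

theory Submission
  imports Defs
begin

text \<open>Let \<open>z = P v\<close>. Monotonicity of \<open>S\<close> and \<open>T\<close> shows that the Lyapunov function
  \<open>a\<^sub>n = |w\<^sub>n - z|\<^sup>2 - 2 \<delta>\<^sub>n\<^sub>-\<^sub>1 \<langle>T w\<^sub>n - T w\<^sub>n\<^sub>-\<^sub>1, w\<^sub>n - z\<rangle> - \<theta>\<^sub>n |w\<^sub>n\<^sub>-\<^sub>1 - z|\<^sup>2 + \<kappa> |w\<^sub>n - w\<^sub>n\<^sub>-\<^sub>1|\<^sup>2\<close>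
  eventually satisfies
  \<open>a\<^sub>n\<^sub>+\<^sub>1 \<le> (1 - \<sigma>\<^sub>n) a\<^sub>n + \<sigma>\<^sub>n b\<^sub>n - \<epsilon> (|w\<^sub>n - w\<^sub>n\<^sub>-\<^sub>1|\<^sup>2 + |w\<^sub>n\<^sub>+\<^sub>1 - w\<^sub>n|\<^sup>2)\<close> with
  \<open>b\<^sub>n \<le> 2 \<langle>v - z, w\<^sub>n\<^sub>+\<^sub>1 - z\<rangle>\<close>, and dominates a multiple of \<open>|w\<^sub>n - z|\<^sup>2\<close>.
  Comparing \<open>w\<^sub>n\<^sub>+\<^sub>1\<close> with the Tikhonov path of \<open>S + T\<close> anchored at \<open>v\<close>, which converges strongly to \<open>z\<close>,
  bounds \<open>b\<^sub>n\<close> by an arbitrarily small constant plus a multiple of \<open>\<sigma>\<^sub>n\<close> and of the two increments.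
  The negative quadratic terms absorb these increments, so \<open>a\<^sub>n\<^sub>+\<^sub>1 \<le> (1 - \<sigma>\<^sub>n) a\<^sub>n + \<sigma>\<^sub>n \<eta>\<close>
  eventually for every \<open>\<eta> > 0\<close>, and \<open>a\<^sub>n\<close> tends to zero. Weak convergence is not needed.\<close>

section \<open>Maximal monotone operators and resolvents\<close>

text \<open>Otherwise the pair could be adjoined to the graph of \<open>S\<close>, producing a
  strictly larger monotone operator.\<close>

lemma maximal_monotone_memI:
  assumes "maximal_monotone S"
    and rel: "\<And>a u. u \<in> S a \<Longrightarrow> inner (u - x') (a - x) \<ge> 0"
  shows "x' \<in> S x"
proof (rule ccontr)
  assume notin: "x' \<notin> S x"
  define B where "B = S(x := insert x' (S x))"
  have mono: "inner (u - b) (a - y) \<ge> 0" if "u \<in> S a" "b \<in> S y" for a u y b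
    using assms(1) that unfolding maximal_monotone_def monotone_operator_def by blast
  have rel': "inner (x' - u) (x - a) \<ge> 0" if "u \<in> S a" for a u
    using rel[OF that] by (simp add: inner_diff_left inner_diff_right algebra_simps)
  have "monotone_operator B"
    unfolding monotone_operator_def B_def
    using mono rel rel' by (auto split: if_splits)
  moreover have "op_graph S \<subset> op_graph B"
    unfolding op_graph_def B_def using notin by (auto split: if_splits)
  ultimately show False
    using assms(1) unfolding maximal_monotone_def by blast
qed

lemma maximal_monotone_inner_nonneg:
  assumes "maximal_monotone S" "u \<in> S a" "u' \<in> S b"
  shows "inner (u - u') (a - b) \<ge> 0"
  using assms unfolding maximal_monotone_def monotone_operator_def by blast

text \<open>An empty graph would satisfy the hypothesis of \<open>maximal_monotone_memI\<close>
  vacuously at the pair (0, 0) and therefore contain it.\<close>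

lemma maximal_monotone_graph_nonempty:
  assumes "maximal_monotone S"
  obtains a u where "u \<in> S a"
  using maximal_monotone_memI[OF assms, of 0 0] by blast

text \<open>The functional below is strongly convex, so minimizing sequences are Cauchy.\<close>

lemma strongly_convex_minimizer:
  fixes K :: "('b::{real_inner,complete_space} \<times> real) set"
  assumes "closed K" "convex K" "K \<noteq> {}"
    and bdd: "\<And>p t. (p, t) \<in> K \<Longrightarrow> m \<le> t + (norm p)\<^sup>2 / 2"
  obtains p0 t0 where "(p0, t0) \<in> K"
    "\<And>p t. (p, t) \<in> K \<Longrightarrow> t0 + (norm p0)\<^sup>2 / 2 \<le> t + (norm p)\<^sup>2 / 2"
proof -
  define q where "q = (\<lambda>k::'b \<times> real. snd k + (norm (fst k))\<^sup>2 / 2)"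
  define I where "I = (INF k\<in>K. q k)"
  have bb: "bdd_below (q ` K)"
    using bdd by (intro bdd_belowI[of _ m]) (auto simp: q_def)
  have I_le: "I \<le> q k" if "k \<in> K" for k
    unfolding I_def using bb that by (rule cINF_lower)
  have "\<exists>k\<in>K. q k < I + 1 / real (Suc n)" for n
  proof -
    have "(INF k\<in>K. q k) < I + 1 / real (Suc n)" unfolding I_def by simp
    then show ?thesis using cINF_less_iff[OF \<open>K \<noteq> {}\<close> bb] by blast
  qed
  then obtain k where kK: "\<And>n. k n \<in> K" and kq: "\<And>n. q (k n) < I + 1 / real (Suc n)"
    by metis
  \<comment> \<open>The midpoint lies in \<open>K\<close> by convexity. By the parallelogram law its
    \<open>q\<close>-value is the average minus an eighth of the squared distance; the real
    coordinate enters affinely and contributes nothing.\<close>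
  have mid: "(norm (fst x - fst y))\<^sup>2 \<le> 4 * (q x - I) + 4 * (q y - I)" if "x \<in> K" "y \<in> K" for x y
  proof -
    have "(1/2) *\<^sub>R x + (1/2) *\<^sub>R y \<in> K"
      using \<open>convex K\<close> that by (intro convexD) auto
    then have "I \<le> q ((1/2) *\<^sub>R x + (1/2) *\<^sub>R y)" by (rule I_le)
    also have "\<dots> = (q x + q y) / 2 - (norm (fst x - fst y))\<^sup>2 / 8"
      unfolding q_def power2_norm_eq_inner
      by (simp add: inner_diff_left inner_diff_right inner_add_left inner_add_right
          inner_commute field_simps)
    finally show ?thesis by (simp add: field_simps)
  qed
  have cau: "Cauchy (\<lambda>n. fst (k n))"
  proof (rule metric_CauchyI)
    fix e :: real assume "e > 0"
    then obtain N where N: "1 / real (Suc N) < e\<^sup>2 / 8"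
      using nat_approx_posE[of "e\<^sup>2 / 8"] by (metis zero_less_divide_iff zero_less_numeral zero_less_power)
    have sm: "q (k n) - I < e\<^sup>2 / 8" if "n \<ge> N" for n
    proof -
      have "1 / real (Suc n) \<le> 1 / real (Suc N)" using that by (simp add: frac_le)
      then show ?thesis using kq[of n] N by linarith
    qed
    have "dist (fst (k i)) (fst (k j)) < e" if "i \<ge> N" "j \<ge> N" for i j
    proof -
      have "(norm (fst (k i) - fst (k j)))\<^sup>2 < e\<^sup>2"
        using mid[OF kK[of i] kK[of j]] sm[OF that(1)] sm[OF that(2)] by (simp add: field_simps)
      then show ?thesis using \<open>e > 0\<close> unfolding dist_norm
        by (meson less_eq_real_def power_less_imp_less_base)
    qed
    then show "\<exists>M. \<forall>i\<ge>M. \<forall>j\<ge>M. dist (fst (k i)) (fst (k j)) < e" by blast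
  qed
  then obtain p0 where p0: "(\<lambda>n. fst (k n)) \<longlonglongrightarrow> p0"
    using Cauchy_convergent_iff convergent_def by blast
  have "(\<lambda>n. q (k n)) \<longlonglongrightarrow> I"
  proof (rule real_tendsto_sandwich[OF _ _ tendsto_const])
    show "\<forall>\<^sub>F n in sequentially. I \<le> q (k n)" "\<forall>\<^sub>F n in sequentially. q (k n) \<le> I + 1 / real (Suc n)"
      using I_le[OF kK] kq by (auto intro!: always_eventually less_imp_le simp del: of_nat_Suc)
    show "(\<lambda>n. I + 1 / real (Suc n)) \<longlonglongrightarrow> I"
      using tendsto_add[OF tendsto_const[of I] LIMSEQ_inverse_real_of_nat]
      by (simp add: inverse_eq_divide)
  qed
  \<comment> \<open>The real coordinate is \<open>q\<close> minus the norm term, so it converges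
    because both do; closedness of \<open>K\<close> then shows that the infimum is attained.\<close>
  then have "(\<lambda>n. q (k n) - (norm (fst (k n)))\<^sup>2 / 2) \<longlonglongrightarrow> I - (norm p0)\<^sup>2 / 2"
    by (intro tendsto_intros p0) auto
  then have "(\<lambda>n. snd (k n)) \<longlonglongrightarrow> I - (norm p0)\<^sup>2 / 2"
    by (simp add: q_def)
  then have "(\<lambda>n. (fst (k n), snd (k n))) \<longlonglongrightarrow> (p0, I - (norm p0)\<^sup>2 / 2)"
    by (intro tendsto_Pair p0)
  then have "(p0, I - (norm p0)\<^sup>2 / 2) \<in> K"
    by (rule closed_sequentially[OF \<open>closed K\<close>, rotated]) (use kK in simp)
  then show thesis
    using that I_le by (fastforce simp: q_def)
qed

text \<open>The set \<open>K\<close> is the epigraph of the Fitzpatrick function of \<open>G\<close>, whose minimization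
  against the squared norm gives the solution (Simons and Zalinescu).\<close>

lemma minty_zero:
  fixes G :: "('a::{real_inner,complete_space} \<times> 'a) set"
  assumes "G \<noteq> {}"
    and mono: "\<And>a u b u'. (a, u) \<in> G \<Longrightarrow> (b, u') \<in> G \<Longrightarrow> inner (u - u') (a - b) \<ge> 0"
    and max: "\<And>x x'. (\<And>a u. (a, u) \<in> G \<Longrightarrow> inner (u - x') (a - x) \<ge> 0) \<Longrightarrow> (x, x') \<in> G"
  obtains x where "(x, - x) \<in> G"
proof -
  define K where "K = (\<Inter>(a, u)\<in>G. {k :: ('a \<times> 'a) \<times> real.
     inner u (fst (fst k)) + inner a (snd (fst k)) - inner u a \<le> snd k})"
  have K_iff: "((x, x'), t) \<in> K \<longleftrightarrow> (\<forall>(a, u)\<in>G. inner u x + inner a x' - inner u a \<le> t)" for x x' t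
    unfolding K_def by auto
  have "closed K"
    unfolding K_def by (intro closed_INT ballI) (auto intro!: closed_Collect_le continuous_intros)
  have "convex K"
  proof (rule convexI)
    fix k l :: "('a \<times> 'a) \<times> real" and s t :: real
    assume *: "k \<in> K" "l \<in> K" "0 \<le> s" "0 \<le> t" "s + t = 1"
    have "inner u (fst (fst (s *\<^sub>R k + t *\<^sub>R l))) + inner a (snd (fst (s *\<^sub>R k + t *\<^sub>R l))) - inner u a
        \<le> snd (s *\<^sub>R k + t *\<^sub>R l)" if "(a, u) \<in> G" for a u
    proof -
      let ?f = "\<lambda>k. inner u (fst (fst k)) + inner a (snd (fst k))"
      have "?f k - inner u a \<le> snd k" "?f l - inner u a \<le> snd l"
        using * that unfolding K_def by auto
      then have "s * (?f k - inner u a) + t * (?f l - inner u a) \<le> s * snd k + t * snd l"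
        using * by (intro add_mono mult_left_mono) auto
      moreover have "s * inner u a + t * inner u a = inner u a"
        using \<open>s + t = 1\<close> by (metis distrib_right mult_1)
      ultimately show ?thesis
        by (simp add: inner_add_right algebra_simps)
    qed
    then show "s *\<^sub>R k + t *\<^sub>R l \<in> K" unfolding K_def by auto
  qed
  have G_K: "((a, u), inner u a) \<in> K" if "(a, u) \<in> G" for a u
    unfolding K_iff
  proof clarify
    fix b u' assume "(b, u') \<in> G"
    then show "inner u' a + inner b u - inner u' b \<le> inner u a"
      using mono[OF that \<open>(b, u') \<in> G\<close>]
      by (simp add: inner_diff_left inner_diff_right inner_commute)
  qed
  \<comment> \<open>If \<open>t\<close> were below the inner product, \<open>(x, x')\<close> would
    be monotonically related to all of \<open>G\<close>, hence in \<open>G\<close> by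
    \<open>max\<close>, and its own defining inequality in \<open>K\<close> would give the opposite
    bound.\<close>
  have fitz: "inner x x' \<le> t" if "((x, x'), t) \<in> K" for x x' t
  proof (rule ccontr)
    assume lt: "\<not> inner x x' \<le> t"
    have "(x, x') \<in> G"
    proof (rule max)
      fix a u assume "(a, u) \<in> G"
      then have "inner u x + inner a x' - inner u a \<le> t" using that K_iff by auto
      then show "inner (u - x') (a - x) \<ge> 0"
        using lt by (simp add: inner_diff_left inner_diff_right inner_commute)
    qed
    then have "inner x' x + inner x x' - inner x' x \<le> t"
      using that K_iff by blast
    then show False using lt by simp
  qed
  have sq: "0 \<le> inner x x' + (norm (x, x'))\<^sup>2 / 2" for x x' :: 'a
  proof -
    have "0 \<le> (norm (x + x'))\<^sup>2" by simp
    then show ?thesis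
      unfolding power2_norm_eq_inner by (simp add: inner_add_left inner_add_right inner_commute field_simps)
  qed
  have "0 \<le> t + (norm p)\<^sup>2 / 2" if "(p, t) \<in> K" for p t
    using fitz[of "fst p" "snd p" t] sq[of "fst p" "snd p"] that by auto
  moreover have "K \<noteq> {}" using G_K \<open>G \<noteq> {}\<close> by auto
  ultimately obtain p0 t0 where p0: "(p0, t0) \<in> K"
    and min: "\<And>p t. (p, t) \<in> K \<Longrightarrow> t0 + (norm p0)\<^sup>2 / 2 \<le> t + (norm p)\<^sup>2 / 2"
    using strongly_convex_minimizer[OF \<open>closed K\<close> \<open>convex K\<close>, of 0] by metis
  obtain x0 u0 where xu: "p0 = (x0, u0)" by fastforce
  \<comment> \<open>First-order optimality: move a fraction \<open>l\<close> of the way to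
    \<open>p\<close> and divide by \<open>l\<close>, which is chosen so that the quadratic remainder
    is at most \<open>e\<close>.\<close>
  have opt: "0 \<le> (t - t0) + inner p0 (p - p0)" if "(p, t) \<in> K" for p t
  proof (rule field_le_epsilon)
    fix e :: real assume "e > 0"
    define l where "l = min 1 (e / ((norm (p - p0))\<^sup>2 + 1))"
    have "0 < (norm (p - p0))\<^sup>2 + 1" by (simp add: add_nonneg_pos)
    then have l: "0 < l" "l \<le> 1" "l * ((norm (p - p0))\<^sup>2 + 1) \<le> e"
      using \<open>e > 0\<close> unfolding l_def
      by (simp_all add: pos_le_divide_eq[symmetric])
    have "(1 - l) *\<^sub>R (p0, t0) + l *\<^sub>R (p, t) \<in> K"
      using \<open>convex K\<close> p0 that l by (intro convexD) auto
    then have "(p0 + l *\<^sub>R (p - p0), t0 + l * (t - t0)) \<in> K"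
      by (simp add: algebra_simps)
    moreover have "(norm (p0 + l *\<^sub>R (p - p0)))\<^sup>2
        = (norm p0)\<^sup>2 + 2 * (l * inner p0 (p - p0)) + l * (l * (norm (p - p0))\<^sup>2)"
      unfolding power2_norm_eq_inner
      by (simp add: inner_add_left inner_add_right inner_commute)
    ultimately have "0 \<le> l * (t - t0) + l * inner p0 (p - p0) + l * (l * (norm (p - p0))\<^sup>2 / 2)"
      using min[of "p0 + l *\<^sub>R (p - p0)" "t0 + l * (t - t0)"] by argo
    also have "\<dots> = l * ((t - t0) + inner p0 (p - p0) + l * (norm (p - p0))\<^sup>2 / 2)"
      by (simp add: algebra_simps)
    finally have "0 \<le> (t - t0) + inner p0 (p - p0) + l * (norm (p - p0))\<^sup>2 / 2"
      using l by (simp add: zero_le_mult_iff)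
    moreover have "l * (norm (p - p0))\<^sup>2 / 2 \<le> e"
    proof -
      have "0 \<le> l * (norm (p - p0))\<^sup>2" using l by simp
      then show ?thesis using l \<open>e > 0\<close> by (simp add: algebra_simps)
    qed
    ultimately show "0 \<le> (t - t0) + inner p0 (p - p0) + e" by linarith
  qed
  have key: "(norm (x0 + u0))\<^sup>2 \<le> inner (u + x0) (a + u0)" if "(a, u) \<in> G" for a u
  proof -
    have "0 \<le> inner u a - t0 + (inner x0 (a - x0) + inner u0 (u - u0))"
      using opt[OF G_K[OF that]] xu by simp
    moreover have "inner x0 u0 \<le> t0" using fitz p0 xu by simp
    moreover have "inner (u + x0) (a + u0) - (norm (x0 + u0))\<^sup>2
        = inner u a + (inner x0 (a - x0) + inner u0 (u - u0)) - inner x0 u0"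
      unfolding power2_norm_eq_inner
      by (simp add: inner_diff_right inner_add_left inner_add_right inner_commute)
    ultimately show ?thesis by linarith
  qed
  \<comment> \<open>The left side of \<open>key\<close> is nonnegative, so this pair is
    monotonically related to \<open>G\<close>. Inserted into \<open>key\<close>, it makes the right
    side vanish and forces \<open>u0 = - x0\<close>.\<close>
  have mem: "(- u0, - x0) \<in> G"
  proof (rule max)
    fix a u assume "(a, u) \<in> G"
    then show "0 \<le> inner (u - - x0) (a - - u0)"
      using key[of a u] by (simp add: order_trans[OF zero_le_power2])
  qed
  from key[OF mem] have "u0 = - x0"
    by (simp add: add_eq_0_iff)
  then show thesis using mem that by simp
qed

text \<open>A solution is a pair \<open>(x, - x)\<close> in the graph of the operator \<delta> S -
  y, which inherits monotonicity and maximality from \<open>S\<close>.\<close>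

theorem minty:
  fixes S :: "'a::{real_inner,complete_space} \<Rightarrow> 'a set"
  assumes S: "maximal_monotone S" and "\<delta> > 0"
  obtains x u where "u \<in> S x" "x + \<delta> *\<^sub>R u = y"
proof -
  define G where "G = {(a, \<delta> *\<^sub>R u - y) | a u. u \<in> S a}"
  obtain a0 u0 where "u0 \<in> S a0" by (rule maximal_monotone_graph_nonempty[OF S])
  then have ne: "G \<noteq> {}" unfolding G_def by blast
  obtain x where "(x, - x) \<in> G"
  proof (rule minty_zero[OF ne])
    fix a u b u' assume "(a, u) \<in> G" "(b, u') \<in> G"
    then obtain s s' where s: "u = \<delta> *\<^sub>R s - y" "s \<in> S a" "u' = \<delta> *\<^sub>R s' - y" "s' \<in> S b"
      unfolding G_def by auto
    then have "u - u' = \<delta> *\<^sub>R (s - s')" by (simp add: scaleR_diff_right)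
    then show "inner (u - u') (a - b) \<ge> 0"
      using maximal_monotone_inner_nonneg[OF S s(2,4)] \<open>\<delta> > 0\<close> by simp
  next
    fix x x' assume *: "\<And>a u. (a, u) \<in> G \<Longrightarrow> inner (u - x') (a - x) \<ge> 0"
    have "(1 / \<delta>) *\<^sub>R (x' + y) \<in> S x"
    proof (rule maximal_monotone_memI[OF S])
      fix a u assume "u \<in> S a"
      then have "inner ((\<delta> *\<^sub>R u - y) - x') (a - x) \<ge> 0" using * unfolding G_def by blast
      moreover have "(\<delta> *\<^sub>R u - y) - x' = \<delta> *\<^sub>R (u - (1 / \<delta>) *\<^sub>R (x' + y))"
        using \<open>\<delta> > 0\<close> by (simp add: algebra_simps)
      ultimately show "inner (u - (1 / \<delta>) *\<^sub>R (x' + y)) (a - x) \<ge> 0"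
        using \<open>\<delta> > 0\<close> by (simp add: zero_le_mult_iff)
    qed
    then have "(x, \<delta> *\<^sub>R ((1 / \<delta>) *\<^sub>R (x' + y)) - y) \<in> G" unfolding G_def by blast
    then show "(x, x') \<in> G" using \<open>\<delta> > 0\<close> by simp
  qed
  then obtain u where "u \<in> S x" "- x = \<delta> *\<^sub>R u - y" unfolding G_def by auto
  then have "x + \<delta> *\<^sub>R u = y"
    by (simp add: neg_eq_iff_add_eq_0 add_diff_eq)
  then show thesis using that \<open>u \<in> S x\<close> by blast
qed

text \<open>Monotonicity lets the \<open>u\<close>-part be added to the square at no cost, and
  Cauchy-Schwarz finishes. The form with graph points is chosen because it is used before
  \<open>resolvent\<close> is known to be well defined.\<close>

lemma resolvent_nonexpansive_rel:
  assumes "maximal_monotone S" "\<delta> > 0" "u \<in> S x" "u' \<in> S x'"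
  shows "norm (x - x') \<le> norm ((x + \<delta> *\<^sub>R u) - (x' + \<delta> *\<^sub>R u'))"
proof -
  have "0 \<le> \<delta> * inner (u - u') (x - x')"
    using maximal_monotone_inner_nonneg[OF assms(1,3,4)] assms(2) by simp
  then have "(norm (x - x'))\<^sup>2 \<le> inner ((x + \<delta> *\<^sub>R u) - (x' + \<delta> *\<^sub>R u')) (x - x')"
    unfolding power2_norm_eq_inner
    by (simp add: inner_diff_left inner_add_left algebra_simps)
  also have "\<dots> \<le> norm ((x + \<delta> *\<^sub>R u) - (x' + \<delta> *\<^sub>R u')) * norm (x - x')"
    by (rule norm_cauchy_schwarz)
  finally show ?thesis
    by (cases "x = x'") (auto simp: power2_eq_square)
qed

text \<open>This justifies the description in \<open>resolvent\<close>: existence is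
  \<open>minty\<close>, uniqueness is \<open>resolvent_nonexpansive_rel\<close> with equal
  right-hand sides.\<close>

lemma resolvent_mem:
  fixes S :: "'a::{real_inner,complete_space} \<Rightarrow> 'a set"
  assumes S: "maximal_monotone S" and "\<delta> > 0"
  obtains u where "u \<in> S (resolvent \<delta> S y)" "resolvent \<delta> S y + \<delta> *\<^sub>R u = y"
proof -
  let ?P = "\<lambda>x. x \<in> op_inverse (\<lambda>z. {z + \<delta> *\<^sub>R u | u. u \<in> S z}) y"
  obtain x u where xu: "u \<in> S x" "x + \<delta> *\<^sub>R u = y" using minty[OF assms] by blast
  have "?P x" using xu unfolding op_inverse_def by blast
  moreover have "x' = x" if P': "?P x'" for x'
  proof -
    obtain u' where "u' \<in> S x'" "y = x' + \<delta> *\<^sub>R u'" using P' unfolding op_inverse_def by blast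
    then show ?thesis using resolvent_nonexpansive_rel[OF assms \<open>u' \<in> S x'\<close> xu(1)] xu(2) by simp
  qed
  ultimately have "?P (resolvent \<delta> S y)" unfolding resolvent_def by (rule theI)
  then obtain u where "u \<in> S (resolvent \<delta> S y)" "y = resolvent \<delta> S y + \<delta> *\<^sub>R u"
    unfolding op_inverse_def by fast
  then show thesis using that by metis
qed

lemma resolvent_nonexpansive:
  fixes S :: "'a::{real_inner,complete_space} \<Rightarrow> 'a set"
  assumes "maximal_monotone S" "\<delta> > 0"
  shows "norm (resolvent \<delta> S x - resolvent \<delta> S y) \<le> norm (x - y)"
proof -
  obtain u where u: "u \<in> S (resolvent \<delta> S x)" "resolvent \<delta> S x + \<delta> *\<^sub>R u = x"
    using resolvent_mem[OF assms] by blast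
  obtain u' where u': "u' \<in> S (resolvent \<delta> S y)" "resolvent \<delta> S y + \<delta> *\<^sub>R u' = y"
    using resolvent_mem[OF assms] by blast
  show ?thesis using resolvent_nonexpansive_rel[OF assms u(1) u'(1)] u(2) u'(2) by simp
qed

section \<open>The Tikhonov path\<close>

text \<open>The operator \<open>B\<close> below is strongly monotone with modulus \<open>t\<close>
  and Lipschitz with constant \<open>M\<close>, so the forward-backward map
  \<open>z \<mapsto> resolvent \<mu> S (z - \<mu> *\<^sub>R B z)\<close> is a contraction. Its fixed
  point satisfies \<open>- B z \<in> S z\<close>.\<close>

lemma tikhonov_point_exists:
  fixes S :: "'a::{real_inner,complete_space} \<Rightarrow> 'a set"
  assumes S: "maximal_monotone S"
    and mono: "\<And>a b. inner (T a - T b) (a - b) \<ge> 0"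
    and lip: "L-lipschitz_on UNIV T"
    and "t > 0"
  obtains z where "t *\<^sub>R (v - z) - T z \<in> S z"
proof -
  define M where "M = L + t"
  have "L \<ge> 0" using lip by (rule lipschitz_on_nonneg)
  then have "M > 0" "t \<le> M" using \<open>t > 0\<close> by (auto simp: M_def)
  \<comment> \<open>This value minimizes
    \<open>1 - 2 * \<mu> * t + \<mu>\<^sup>2 * M\<^sup>2\<close>, the squared contraction factor;
    the minimum is \<open>k\<^sup>2\<close>.\<close>
  define \<mu> where "\<mu> = t / M\<^sup>2"
  have "\<mu> > 0" unfolding \<mu>_def using \<open>t > 0\<close> \<open>M > 0\<close> by simp
  define B where "B = (\<lambda>z. T z + t *\<^sub>R (z - v))"
  define k where "k = sqrt (1 - (t / M)\<^sup>2)"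
  have tM: "0 < (t / M)\<^sup>2" "(t / M)\<^sup>2 \<le> 1"
    using \<open>t > 0\<close> \<open>M > 0\<close> \<open>t \<le> M\<close> by (auto simp: power_le_one)
  then have k: "0 \<le> k" "k < 1" "k\<^sup>2 = 1 - (t / M)\<^sup>2" unfolding k_def by auto
  have B_lip: "norm (B x - B y) \<le> M * norm (x - y)" for x y
  proof -
    have "B x - B y = (T x - T y) + t *\<^sub>R (x - y)" unfolding B_def by (simp add: algebra_simps)
    moreover have "norm (T x - T y) \<le> L * norm (x - y)"
      using lipschitz_onD[OF lip, of x y] by (simp add: dist_norm)
    moreover have "norm (t *\<^sub>R (x - y)) = t * norm (x - y)" using \<open>t > 0\<close> by simp
    ultimately show ?thesis
      using norm_triangle_ineq[of "T x - T y" "t *\<^sub>R (x - y)"]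
      unfolding M_def distrib_right by (smt (verit))
  qed
  have B_mono: "t * (norm (x - y))\<^sup>2 \<le> inner (B x - B y) (x - y)" for x y
  proof -
    have "B x - B y = (T x - T y) + t *\<^sub>R (x - y)" unfolding B_def by (simp add: algebra_simps)
    then show ?thesis
      using mono[of x y] by (simp only: inner_add_left inner_scaleR_left power2_norm_eq_inner)
  qed
  have contr: "norm ((x - \<mu> *\<^sub>R B x) - (y - \<mu> *\<^sub>R B y)) \<le> k * norm (x - y)" for x y
  proof (rule power2_le_imp_le)
    have "(x - \<mu> *\<^sub>R B x) - (y - \<mu> *\<^sub>R B y) = (x - y) - \<mu> *\<^sub>R (B x - B y)"
      by (simp add: algebra_simps)
    moreover have "(norm (a - \<mu> *\<^sub>R b))\<^sup>2 = (norm a)\<^sup>2 - 2 * \<mu> * inner b a + \<mu>\<^sup>2 * (norm b)\<^sup>2" for a b :: 'a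
      unfolding power2_norm_eq_inner
      by (simp add: inner_diff_left inner_diff_right inner_commute power2_eq_square algebra_simps)
    ultimately have "(norm ((x - \<mu> *\<^sub>R B x) - (y - \<mu> *\<^sub>R B y)))\<^sup>2
        = (norm (x - y))\<^sup>2 - 2 * \<mu> * inner (B x - B y) (x - y) + \<mu>\<^sup>2 * (norm (B x - B y))\<^sup>2"
      by (simp only:)
    also have "\<dots> \<le> (norm (x - y))\<^sup>2 - 2 * \<mu> * (t * (norm (x - y))\<^sup>2) + \<mu>\<^sup>2 * (M * norm (x - y))\<^sup>2"
      using B_mono[of x y] B_lip[of x y] \<open>\<mu> > 0\<close>
      by (intro add_mono diff_mono mult_left_mono power_mono) auto
    also have "\<dots> = (1 - 2 * \<mu> * t + \<mu>\<^sup>2 * M\<^sup>2) * (norm (x - y))\<^sup>2"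
      by (simp add: algebra_simps power_mult_distrib)
    also have "1 - 2 * \<mu> * t + \<mu>\<^sup>2 * M\<^sup>2 = k\<^sup>2"
      unfolding k \<mu>_def using \<open>M > 0\<close> by (simp add: field_simps power2_eq_square)
    finally show "(norm ((x - \<mu> *\<^sub>R B x) - (y - \<mu> *\<^sub>R B y)))\<^sup>2 \<le> (k * norm (x - y))\<^sup>2"
      by (simp add: power_mult_distrib)
  qed (use k in simp)
  have "\<exists>!z. resolvent \<mu> S (z - \<mu> *\<^sub>R B z) = z"
  proof (rule banach_fix_type[OF k(1,2)], intro allI)
    fix x y :: 'a
    show "dist (resolvent \<mu> S (x - \<mu> *\<^sub>R B x)) (resolvent \<mu> S (y - \<mu> *\<^sub>R B y)) \<le> k * dist x y"
      unfolding dist_norm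
      using resolvent_nonexpansive[OF S \<open>\<mu> > 0\<close>] contr by (rule order_trans)
  qed
  then obtain z where z: "resolvent \<mu> S (z - \<mu> *\<^sub>R B z) = z" by blast
  obtain u where u: "u \<in> S z" "z + \<mu> *\<^sub>R u = z - \<mu> *\<^sub>R B z"
    by (rule resolvent_mem[OF S \<open>\<mu> > 0\<close>, of "z - \<mu> *\<^sub>R B z", unfolded z])
  then have "\<mu> *\<^sub>R u = \<mu> *\<^sub>R (- B z)"
    by (metis add_left_cancel diff_conv_add_uminus scaleR_minus_right)
  then have "u = - B z" using \<open>\<mu> > 0\<close> scaleR_left_imp_eq[of \<mu> u "- B z"] by blast
  then have "u = t *\<^sub>R (v - z) - T z" unfolding B_def by (simp add: algebra_simps)
  then show thesis using that u(1) by blast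
qed

text \<open>As the regularization parameter decreases, the residuals \<open>v - z\<close> grow in norm but stay
  bounded, and their distances are controlled by the increments of the squared norms, so the path
  is Cauchy.\<close>

theorem tikhonov_path_converges:
  fixes S :: "'a::{real_inner,complete_space} \<Rightarrow> 'a set"
  assumes S: "maximal_monotone S"
    and mono: "\<And>a b. inner (T a - T b) (a - b) \<ge> 0"
    and lip: "L-lipschitz_on UNIV T"
    and ne: "- T z1 \<in> S z1"
  obtains z t y where "- T z \<in> S z"
    "\<And>z'. - T z' \<in> S z' \<Longrightarrow> inner (v - z) (z' - z) \<le> 0"
    "\<And>n::nat. t n > 0" "\<And>n. t n *\<^sub>R (v - y n) - T (y n) \<in> S (y n)" "y \<longlonglongrightarrow> z"
proof -
  define t where "t = (\<lambda>n::nat. inverse (real (Suc n)))"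
  have t: "t n > 0" for n unfolding t_def by simp
  have t_anti: "t n \<le> t m" if "m \<le> n" for m n
    using that unfolding t_def by (simp add: field_simps)
  have t_lim: "t \<longlonglongrightarrow> 0" unfolding t_def by (rule LIMSEQ_inverse_real_of_nat)
  have "\<exists>z. t n *\<^sub>R (v - z) - T z \<in> S z" for n
    using tikhonov_point_exists[OF S mono lip t] by metis
  then obtain y where y: "\<And>n. t n *\<^sub>R (v - y n) - T (y n) \<in> S (y n)" by metis
  have rel: "inner (p - q) (a - b) \<ge> 0" if "p - T a \<in> S a" "q - T b \<in> S b" for p q a b
  proof -
    have "inner ((p - T a) - (q - T b)) (a - b) \<ge> 0"
      by (rule maximal_monotone_inner_nonneg[OF S that])
    moreover have "p - q = ((p - T a) - (q - T b)) + (T a - T b)" by simp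
    ultimately show ?thesis using mono[of a b] by (metis add_nonneg_nonneg inner_add_left)
  qed
  have zero: "inner (v - y n) (z' - y n) \<le> 0" if "- T z' \<in> S z'" for z' n
  proof -
    have "0 \<le> inner (t n *\<^sub>R (v - y n) - 0) (y n - z')"
      by (rule rel) (use y that in auto)
    then show ?thesis using t[of n]
      by (simp add: zero_le_mult_iff inner_diff_right)
  qed
  define x where "x = (\<lambda>n. v - y n)"
  have gap: "0 \<le> (norm (x n))\<^sup>2 - (norm (x m))\<^sup>2 \<and> (norm (x n - x m))\<^sup>2 \<le> (norm (x n))\<^sup>2 - (norm (x m))\<^sup>2"
    if "m \<le> n" for m n
  proof -
    have "0 \<le> inner (t m *\<^sub>R x m - t n *\<^sub>R x n) (y m - y n)"
      unfolding x_def by (rule rel) (rule y)+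
    also have "y m - y n = x n - x m" unfolding x_def by simp
    finally have *: "t m * (norm (x m))\<^sup>2 + t n * (norm (x n))\<^sup>2 \<le> (t m + t n) * inner (x n) (x m)"
      unfolding power2_norm_eq_inner
      by (simp add: inner_diff_left inner_diff_right inner_commute algebra_simps)
    let ?N = "(norm (x n))\<^sup>2 - (norm (x m))\<^sup>2"
    have d: "(norm (x n - x m))\<^sup>2 = (norm (x n))\<^sup>2 + (norm (x m))\<^sup>2 - 2 * inner (x n) (x m)"
      unfolding power2_norm_eq_inner by (simp add: inner_diff_left inner_diff_right inner_commute)
    have "(t m + t n) * (norm (x n - x m))\<^sup>2
        = (t m + t n) * ((norm (x n))\<^sup>2 + (norm (x m))\<^sup>2) - 2 * ((t m + t n) * inner (x n) (x m))"
      unfolding d by (simp add: algebra_simps)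
    \<comment> \<open>The factor on the right is nonnegative and at most the one on the left. Hence
      \<open>?N\<close> cannot be negative, since that would force \<open>x n = x m\<close> and
      \<open>?N = 0\<close>, and the squared distance is at most \<open>?N\<close>.\<close>
    then have le: "(t m + t n) * (norm (x n - x m))\<^sup>2 \<le> (t m - t n) * ?N"
      using * by (simp add: algebra_simps)
    have tt: "t n \<le> t m" "0 < t n" using t_anti[OF that] t by auto
    show ?thesis
    proof (cases "?N \<ge> 0")
      case True
      then have "(t m - t n) * ?N \<le> (t m + t n) * ?N" using tt by (intro mult_right_mono) auto
      then have "(t m + t n) * (norm (x n - x m))\<^sup>2 \<le> (t m + t n) * ?N" using le by linarith
      then show ?thesis using True tt by (simp add: mult_le_cancel_left)
    next
      case False
      then have "(t m - t n) * ?N \<le> 0" using tt by (intro mult_nonneg_nonpos) auto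
      then have "(t m + t n) * (norm (x n - x m))\<^sup>2 \<le> 0" using le by linarith
      then have "(norm (x n - x m))\<^sup>2 \<le> 0" using tt by (simp add: mult_le_0_iff)
      then show ?thesis using False by simp
    qed
  qed
  \<comment> \<open>Testing \<open>zero\<close> at the given zero \<open>z1\<close> and applying
    Cauchy-Schwarz bounds the residuals uniformly.\<close>
  have "norm (x n) \<le> norm (v - z1)" for n
  proof -
    have "0 \<le> inner (x n) (y n - z1)" using zero[OF ne, of n] unfolding x_def
      by (simp add: inner_diff_right)
    then have "(norm (x n))\<^sup>2 \<le> inner (x n) (v - z1)"
      unfolding x_def power2_norm_eq_inner by (simp add: inner_diff_right)
    also have "\<dots> \<le> norm (x n) * norm (v - z1)" by (rule norm_cauchy_schwarz)
    finally show ?thesis by (cases "x n = 0") (auto simp: power2_eq_square)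
  qed
  then have "Bseq (\<lambda>n. (norm (x n))\<^sup>2)"
    by (intro BseqI'[of _ "(norm (v - z1))\<^sup>2"]) (auto intro: power_mono)
  moreover have "incseq (\<lambda>n. (norm (x n))\<^sup>2)"
    using gap by (auto simp: incseq_def)
  ultimately have "Cauchy (\<lambda>n. (norm (x n))\<^sup>2)"
    using Bseq_monoseq_convergent incseq_imp_monoseq convergent_Cauchy by blast
  have "Cauchy x"
  proof (rule metric_CauchyI)
    fix e :: real assume "e > 0"
    then obtain N where N: "\<And>m n. m \<ge> N \<Longrightarrow> n \<ge> N \<Longrightarrow> dist ((norm (x m))\<^sup>2) ((norm (x n))\<^sup>2) < e\<^sup>2"
      using metric_CauchyD[OF \<open>Cauchy (\<lambda>n. (norm (x n))\<^sup>2)\<close>, of "e\<^sup>2"] by auto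
    have le: "dist (x n) (x m) < e" if "m \<ge> N" "n \<ge> m" for m n
    proof -
      have "(norm (x n - x m))\<^sup>2 < e\<^sup>2"
        using gap[OF that(2)] N[of n m] that by (auto simp: dist_real_def)
      then show ?thesis using \<open>e > 0\<close> unfolding dist_norm
        by (meson less_eq_real_def power_less_imp_less_base)
    qed
    then have "dist (x m) (x n) < e" if "m \<ge> N" "n \<ge> N" for m n
      using that le[of m n] le[of n m] by (metis dist_commute nat_le_linear)
    then show "\<exists>M. \<forall>m\<ge>M. \<forall>n\<ge>M. dist (x m) (x n) < e" by blast
  qed
  then obtain x0 where x0: "x \<longlonglongrightarrow> x0"
    using Cauchy_convergent_iff convergent_def by blast
  define z where "z = v - x0"
  have "(\<lambda>n. v - x n) \<longlonglongrightarrow> z" unfolding z_def by (intro tendsto_intros x0)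
  then have yz: "y \<longlonglongrightarrow> z" unfolding x_def by simp
  have "isCont T z"
    using lipschitz_on_continuous_on[OF lip] by (simp add: continuous_on_eq_continuous_at)
  then have Ty: "(\<lambda>n. T (y n)) \<longlonglongrightarrow> T z" using yz by (rule isCont_tendsto_compose)
  \<comment> \<open>Monotone relatedness to each graph point passes to the limit along the path, and
    maximality turns it into membership.\<close>
  have zS: "- T z \<in> S z"
  proof (rule maximal_monotone_memI[OF S])
    fix a u assume "u \<in> S a"
    have "(\<lambda>n. inner (u - (t n *\<^sub>R (v - y n) - T (y n))) (a - y n))
        \<longlonglongrightarrow> inner (u - (0 *\<^sub>R (v - z) - T z)) (a - z)"
      by (intro tendsto_intros t_lim yz Ty)
    then have "0 \<le> inner (u - (0 *\<^sub>R (v - z) - T z)) (a - z)"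
      by (rule LIMSEQ_le_const) (use maximal_monotone_inner_nonneg[OF S \<open>u \<in> S a\<close> y] in blast)
    then show "0 \<le> inner (u - - T z) (a - z)" by simp
  qed
  moreover have "inner (v - z) (z' - z) \<le> 0" if "- T z' \<in> S z'" for z'
  proof (rule LIMSEQ_le_const2)
    show "(\<lambda>n. inner (v - y n) (z' - y n)) \<longlonglongrightarrow> inner (v - z) (z' - z)"
      by (intro tendsto_intros yz)
  qed (use zero[OF that] in blast)
  ultimately show thesis using that t y yz by blast
qed

text \<open>The variational inequality fixes the sign of the cross term in the expanded square. The
  resulting \<open>pyth\<close> gives both minimality and the uniqueness that \<open>THE\<close>
  demands.\<close>

lemma metric_projection_eqI:
  fixes z :: "'a::real_inner"
  assumes "z \<in> C" and var: "\<And>z'. z' \<in> C \<Longrightarrow> inner (v - z) (z' - z) \<le> 0"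
  shows "metric_projection C v = z"
proof -
  have pyth: "(dist v z)\<^sup>2 + (dist z z')\<^sup>2 \<le> (dist v z')\<^sup>2" if "z' \<in> C" for z'
  proof -
    have "(dist v z')\<^sup>2 = (dist v z)\<^sup>2 + (dist z z')\<^sup>2 - 2 * inner (v - z) (z' - z)"
      unfolding dist_norm power2_norm_eq_inner
      by (simp add: inner_diff_left inner_diff_right inner_commute)
    then show ?thesis using var[OF that] by simp
  qed
  show ?thesis
    unfolding metric_projection_def
  proof (rule the_equality)
    show "z \<in> C \<and> (\<forall>y\<in>C. dist v z \<le> dist v y)"
    proof (intro conjI ballI \<open>z \<in> C\<close>)
      fix y assume "y \<in> C"
      then have "(dist v z)\<^sup>2 \<le> (dist v y)\<^sup>2"
        using pyth[of y] zero_le_power2[of "dist z y"] by linarith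
      then show "dist v z \<le> dist v y" by (rule power2_le_imp_le) simp
    qed
  next
    fix p assume p: "p \<in> C \<and> (\<forall>y\<in>C. dist v p \<le> dist v y)"
    then have "(dist v p)\<^sup>2 \<le> (dist v z)\<^sup>2" using \<open>z \<in> C\<close> by (intro power_mono) auto
    then have "(dist z p)\<^sup>2 \<le> 0" using pyth[of p] p by linarith
    then show "p = z" by simp
  qed
qed

text \<open>Along approximate zeros of \<open>S + T\<close> the variational inequality characterizing the projection
  holds approximately. Comparing with a point of the Tikhonov path replaces the usual
  weak-compactness argument.\<close>

lemma approximate_zeros_variational:
  fixes S :: "'a::{real_inner,complete_space} \<Rightarrow> 'a set"
  assumes S: "maximal_monotone S"
    and mono: "\<And>a b. inner (T a - T b) (a - b) \<ge> 0"
    and path: "\<And>n::nat. t n > 0" "\<And>n. t n *\<^sub>R (v - y n) - T (y n) \<in> S (y n)" "y \<longlonglongrightarrow> z"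
    and "\<eta> > 0"
  obtains K where "K \<ge> 0"
    "\<And>p q. q - T p \<in> S p \<Longrightarrow> norm (p - z) \<le> M \<Longrightarrow> inner (v - z) (p - z) \<le> \<eta> + K * norm q"
proof -
  \<comment> \<open>This quantity is the total error of replacing \<open>z\<close> by
    \<open>y n\<close> in \<open>inner (v - z) (p - z)\<close>, as estimated in facts 2 and 3
    below.\<close>
  have "(\<lambda>n. norm (y n - z) * (\<bar>M\<bar> + norm (v - y n))) \<longlonglongrightarrow> norm (z - z) * (\<bar>M\<bar> + norm (v - z))"
    by (intro tendsto_intros path)
  then have "\<forall>\<^sub>F n in sequentially. norm (y n - z) * (\<bar>M\<bar> + norm (v - y n)) < \<eta>"
    using \<open>\<eta> > 0\<close> by (intro order_tendstoD) auto
  then obtain n where n: "norm (y n - z) * (\<bar>M\<bar> + norm (v - y n)) < \<eta>"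
    using eventually_happens'[OF sequentially_bot] by blast
  \<comment> \<open>The factor \<open>1 / t n\<close> is harmless: \<open>n\<close> depends only on
    \<eta> and \<open>M\<close>, not on \<open>p\<close> or \<open>q\<close>.\<close>
  define K where "K = (\<bar>M\<bar> + norm (z - y n)) / t n"
  have "inner (v - z) (p - z) \<le> \<eta> + K * norm q" if pq: "q - T p \<in> S p" "norm (p - z) \<le> M" for p q
  proof -
    have "0 \<le> inner ((q - T p) - (t n *\<^sub>R (v - y n) - T (y n))) (p - y n)"
      by (rule maximal_monotone_inner_nonneg[OF S pq(1) path(2)])
    moreover have "0 \<le> inner (T p - T (y n)) (p - y n)" by (rule mono)
    ultimately have "t n * inner (v - y n) (p - y n) \<le> inner q (p - y n)"
      by (simp add: inner_diff_left)
    also have "\<dots> \<le> norm q * norm (p - y n)" by (rule norm_cauchy_schwarz)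
    also have "\<dots> \<le> norm q * (\<bar>M\<bar> + norm (z - y n))"
      using norm_triangle_ineq[of "p - z" "z - y n"] pq(2) by (intro mult_left_mono) auto
    finally have 1: "inner (v - y n) (p - y n) \<le> K * norm q"
      using path(1)[of n] by (simp add: K_def field_simps)
    have "inner (y n - z) (p - z) \<le> norm (y n - z) * norm (p - z)"
      by (rule norm_cauchy_schwarz)
    also have "\<dots> \<le> norm (y n - z) * \<bar>M\<bar>" using pq(2) by (intro mult_left_mono) auto
    finally have 2: "inner (y n - z) (p - z) \<le> norm (y n - z) * \<bar>M\<bar>" .
    have 3: "inner (v - y n) (y n - z) \<le> norm (y n - z) * norm (v - y n)"
      using norm_cauchy_schwarz[of "v - y n" "y n - z"] by (simp add: mult.commute)
    have "inner (v - z) (p - z)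
        = inner (v - y n) (p - y n) + inner (y n - z) (p - z) + inner (v - y n) (y n - z)"
      by (simp add: inner_diff_left inner_diff_right)
    then show ?thesis using 1 2 3 n by (simp add: distrib_left)
  qed
  moreover have "K \<ge> 0" unfolding K_def using path(1)[of n] by simp
  ultimately show thesis using that by blast
qed

section \<open>Recursive inequalities and step sizes\<close>

text \<open>The excess of \<open>a n\<close> over \<open>e / 2\<close> contracts by
  \<open>1 - \<sigma> n \<le> exp (- \<sigma> n)\<close>. The product of these factors is the
  exponential of minus a divergent sum, so it tends to 0.\<close>

lemma recursive_inequality_tendsto_0:
  fixes a \<sigma> :: "nat \<Rightarrow> real"
  assumes a_nonneg: "\<forall>\<^sub>F n in sequentially. 0 \<le> a n"
    and \<sigma>: "\<And>n. n \<ge> 1 \<Longrightarrow> 0 < \<sigma> n \<and> \<sigma> n < 1"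
    and \<sigma>_sum: "filterlim (\<lambda>N. \<Sum>n=1..N. \<sigma> n) at_top at_top"
    and rec: "\<And>\<eta>. \<eta> > 0 \<Longrightarrow> \<forall>\<^sub>F n in sequentially. a (Suc n) \<le> (1 - \<sigma> n) * a n + \<sigma> n * \<eta>"
  shows "a \<longlonglongrightarrow> 0"
proof (rule order_tendstoI)
  fix e :: real assume "e > 0"
  \<comment> \<open>The half-open range starting at 1 makes \<open>\<sigma> n\<close> the increment
    from \<open>Q n\<close> to \<open>Q (Suc n)\<close> and leaves out the unconstrained
    \<open>\<sigma> 0\<close>.\<close>
  define Q where "Q = (\<lambda>n. \<Sum>i=1..<n. \<sigma> i)"
  have Q_Suc: "Q (Suc n) = Q n + \<sigma> n" if "n \<ge> 1" for n
    using that by (simp add: Q_def)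
  have "filterlim (\<lambda>n. Q (Suc n)) at_top sequentially"
    using \<sigma>_sum by (simp add: Q_def atLeastLessThanSuc_atLeastAtMost)
  then have Q: "filterlim Q at_top sequentially"
    by (simp add: filterlim_sequentially_Suc)
  obtain N where N: "\<And>n. n \<ge> N \<Longrightarrow> a (Suc n) \<le> (1 - \<sigma> n) * a n + \<sigma> n * (e / 2)"
    using rec[of "e / 2"] \<open>e > 0\<close> by (auto simp: eventually_sequentially)
  define p where "p = (\<lambda>n. max (a n - e / 2) 0)"
  have p_Suc: "p (Suc n) \<le> exp (- \<sigma> n) * p n" if "n \<ge> max N 1" for n
  proof -
    have s: "0 \<le> 1 - \<sigma> n" "1 - \<sigma> n \<le> exp (- \<sigma> n)"
      using \<sigma>[of n] that exp_ge_add_one_self[of "- \<sigma> n"] by auto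
    have "a (Suc n) - e / 2 \<le> (1 - \<sigma> n) * (a n - e / 2)"
      using N[of n] that by (simp add: field_simps)
    also have "\<dots> \<le> (1 - \<sigma> n) * p n" using s by (intro mult_left_mono) (auto simp: p_def)
    finally have "p (Suc n) \<le> (1 - \<sigma> n) * p n" using s by (simp add: p_def)
    also have "\<dots> \<le> exp (- \<sigma> n) * p n" using s by (intro mult_right_mono) (auto simp: p_def)
    finally show ?thesis .
  qed
  define N1 where "N1 = max N 1"
  have bound: "p n \<le> exp (Q N1 - Q n) * p N1" if "n \<ge> N1" for n
    using that
  proof (induction n rule: dec_induct)
    case (step n)
    have "p (Suc n) \<le> exp (- \<sigma> n) * p n" using p_Suc step by (simp add: N1_def)
    also have "\<dots> \<le> exp (- \<sigma> n) * (exp (Q N1 - Q n) * p N1)"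
      using step by (intro mult_left_mono) auto
    also have "\<dots> = exp (Q N1 - Q (Suc n)) * p N1"
      using step Q_Suc[of n] by (simp add: N1_def algebra_simps flip: exp_add)
    finally show ?case .
  qed simp
  have "filterlim (\<lambda>n. - Q N1 + Q n) at_top sequentially"
    by (rule filterlim_tendsto_add_at_top[OF tendsto_const Q])
  then have "filterlim (\<lambda>n. - (- Q N1 + Q n)) at_bot sequentially"
    by (simp only: filterlim_uminus_at_top)
  then have "(\<lambda>n. exp (- (- Q N1 + Q n))) \<longlonglongrightarrow> 0"
    by (rule filterlim_compose[OF exp_at_bot])
  then have "(\<lambda>n. exp (Q N1 - Q n)) \<longlonglongrightarrow> 0" by simp
  then have "(\<lambda>n. exp (Q N1 - Q n) * p N1) \<longlonglongrightarrow> 0" by (rule tendsto_mult_left_zero)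
  then have "\<forall>\<^sub>F n in sequentially. exp (Q N1 - Q n) * p N1 < e / 2"
    using \<open>e > 0\<close> by (intro order_tendstoD) auto
  moreover have "\<forall>\<^sub>F n in sequentially. n \<ge> N1" by (rule eventually_ge_at_top)
  ultimately show "\<forall>\<^sub>F n in sequentially. a n < e"
  proof eventually_elim
    case (elim n)
    then have "p n < e / 2" using bound[of n] by linarith
    moreover have "a n - e / 2 \<le> p n" by (simp add: p_def)
    ultimately show ?case by linarith
  qed
next
  fix e :: real assume "e < 0"
  then show "\<forall>\<^sub>F n in sequentially. e < a n"
    by (intro eventually_mono[OF a_nonneg]) auto
qed

text \<open>Lipschitz continuity keeps the quotient in the step rule above \<open>r / L\<close>, so
  the steps stay away from 0. They grow by at most \<open>c n\<close>, so they are a decreasing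
  sequence plus partial sums of a convergent series.\<close>

lemma adaptive_steps_converge:
  fixes T :: "'a::real_normed_vector \<Rightarrow> 'a" and \<delta> c :: "nat \<Rightarrow> real"
  assumes "r > 0" "L > 0" and lip: "L-lipschitz_on UNIV T"
    and "\<delta> 1 > 0"
    and c_nonneg: "\<forall>n\<ge>1. 0 \<le> c n"
    and c_summable: "summable (\<lambda>n. c (Suc n))"
    and \<delta>_step: "\<forall>n\<ge>1. \<delta> (n + 1) =
          (if T (w n) \<noteq> T (w (n + 1))
           then min (r * norm (w n - w (n + 1)) / norm (T (w n) - T (w (n + 1)))) (\<delta> n + c n)
           else \<delta> n + c n)"
  obtains m d where "m > 0" "\<And>n. n \<ge> 1 \<Longrightarrow> m \<le> \<delta> n" "\<delta> \<longlonglongrightarrow> d" "d > 0"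
    "\<And>n. n \<ge> 1 \<Longrightarrow> \<delta> (Suc n) * norm (T (w (Suc n)) - T (w n)) \<le> r * norm (w (Suc n) - w n)"
proof -
  define m where "m = min (\<delta> 1) (r / L)"
  have "m > 0" using assms by (simp add: m_def)
  have lower: "m \<le> \<delta> n" if "n \<ge> 1" for n
    using that
  proof (induction n rule: dec_induct)
    case base
    then show ?case by (simp add: m_def)
  next
    case (step n)
    let ?D = "norm (T (w n) - T (w (n + 1)))"
    have "r / L \<le> r * norm (w n - w (n + 1)) / ?D" if "T (w n) \<noteq> T (w (n + 1))"
    proof -
      have "?D > 0" using that by simp
      moreover have "?D \<le> L * norm (w n - w (n + 1))"
        using lipschitz_onD[OF lip, of "w n" "w (n + 1)"] by (simp add: dist_norm)
      then have "r * ?D \<le> r * (L * norm (w n - w (n + 1)))"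
        using \<open>r > 0\<close> by (intro mult_left_mono) auto
      ultimately show ?thesis using \<open>L > 0\<close> by (simp add: field_simps)
    qed
    moreover have "m \<le> \<delta> n + c n" using step c_nonneg by (simp add: add_increasing2)
    moreover have "m \<le> r / L" by (simp add: m_def)
    ultimately have "m \<le> \<delta> (n + 1)" using \<delta>_step step by auto
    then show ?case by simp
  qed
  have upper: "\<delta> (Suc n) \<le> \<delta> n + c n" if "n \<ge> 1" for n
    using \<delta>_step that by auto
  \<comment> \<open>The sum runs over \<open>c 1\<close> to \<open>c n\<close>, exactly the
    increases allowed between \<open>\<delta> 1\<close> and \<open>\<delta> (Suc n)\<close>.\<close>
  define g where "g = (\<lambda>n. \<delta> (Suc n) - (\<Sum>k<n. c (Suc k)))"
  have "decseq g"
    using upper[of "Suc n" for n] by (simp add: decseq_Suc_iff g_def algebra_simps)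
  moreover have "m - (\<Sum>k. c (Suc k)) \<le> g n" for n
    using lower[of "Suc n"] sum_le_suminf[OF c_summable, of "{..<n}"] c_nonneg
    by (simp add: g_def)
  ultimately obtain l where "g \<longlonglongrightarrow> l"
    using decseq_convergent by blast
  then have "(\<lambda>n. g n + (\<Sum>k<n. c (Suc k))) \<longlonglongrightarrow> l + (\<Sum>k. c (Suc k))"
    using summable_LIMSEQ[OF c_summable] by (rule tendsto_add)
  then have lim: "\<delta> \<longlonglongrightarrow> l + (\<Sum>k. c (Suc k))"
    by (simp add: g_def filterlim_sequentially_Suc)
  have "m \<le> l + (\<Sum>k. c (Suc k))"
    using lim lower by (intro LIMSEQ_le_const) auto
  then have "l + (\<Sum>k. c (Suc k)) > 0" using \<open>m > 0\<close> by linarith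
  moreover have "\<delta> (Suc n) * norm (T (w (Suc n)) - T (w n)) \<le> r * norm (w (Suc n) - w n)"
    if "n \<ge> 1" for n
  proof (cases "T (w (Suc n)) = T (w n)")
    case True
    then show ?thesis using \<open>r > 0\<close> by simp
  next
    case False
    then have "\<delta> (Suc n) \<le> r * norm (w n - w (Suc n)) / norm (T (w n) - T (w (Suc n)))"
      using \<delta>_step that by auto
    then show ?thesis using False by (simp add: field_simps norm_minus_commute)
  qed
  ultimately show thesis using that \<open>m > 0\<close> lower lim by blast
qed

text \<open>Monotonicity is applied between \<open>w\<^sub>1\<close> and \<open>z\<close>, with
  \<open>T w\<^sub>1\<close> split as \<open>T w\<close> plus a difference. That difference
  reappears with index shifted by one as the correction term of the next step, so the inner products
  match on both sides of the recursion.\<close>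

lemma reflected_step_energy:
  fixes S :: "'a::real_inner \<Rightarrow> 'a set"
  assumes S: "maximal_monotone S"
    and mono: "\<And>a b. inner (T a - T b) (a - b) \<ge> 0"
    and "0 \<le> \<theta>" "0 \<le> \<sigma>" "\<sigma> \<le> 1" "0 \<le> \<delta>'" "0 < \<delta>" "0 \<le> \<rho>"
    and zero: "- T z \<in> S z"
    and u: "u \<in> S w\<^sub>1"
    and step: "w\<^sub>1 + \<delta> *\<^sub>R u = \<sigma> *\<^sub>R v + (1 - \<sigma>) *\<^sub>R (w + \<theta> *\<^sub>R (w - w'))
       - \<delta> *\<^sub>R T w - (\<delta>' * (1 - \<sigma>)) *\<^sub>R (T w - T w')"
    and lip: "\<delta>' * norm (T w - T w') \<le> \<rho> * norm (w - w')"
  shows "(norm (w\<^sub>1 - z))\<^sup>2 - 2 * \<delta> * inner (T w\<^sub>1 - T w) (w\<^sub>1 - z)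
    \<le> \<sigma> * ((norm (v - z))\<^sup>2 - (norm (v - w\<^sub>1))\<^sup>2)
      + (1 - \<sigma>) * ((norm (w - z))\<^sup>2 - 2 * \<delta>' * inner (T w - T w') (w - z)
        + \<theta> * ((norm (w - z))\<^sup>2 - (norm (w' - z))\<^sup>2)
        + (2 * \<theta> + \<rho>) * (norm (w - w'))\<^sup>2 - (1 - \<theta> - \<rho>) * (norm (w\<^sub>1 - w))\<^sup>2)"
proof -
  define x where "x = w + \<theta> *\<^sub>R (w - w')"
  define G where "G = T w - T w'"
  define p q s where "p = w - z" and "q = w - w'" and "s = w\<^sub>1 - w"
  have "0 \<le> \<delta> * inner (u - - T z) (w\<^sub>1 - z) + \<delta> * inner (T w\<^sub>1 - T z) (w\<^sub>1 - z)"
    using maximal_monotone_inner_nonneg[OF S u zero] mono[of w\<^sub>1 z] \<open>0 < \<delta>\<close> by simp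
  also have "\<dots> = inner (\<delta> *\<^sub>R u + \<delta> *\<^sub>R T w) (w\<^sub>1 - z) + \<delta> * inner (T w\<^sub>1 - T w) (w\<^sub>1 - z)"
    by (simp add: inner_diff_left inner_add_left algebra_simps)
  also have "\<delta> *\<^sub>R u + \<delta> *\<^sub>R T w = \<sigma> *\<^sub>R (v - w\<^sub>1) + (1 - \<sigma>) *\<^sub>R (x - w\<^sub>1) - (\<delta>' * (1 - \<sigma>)) *\<^sub>R G"
  proof -
    have "\<delta> *\<^sub>R u + \<delta> *\<^sub>R T w = (w\<^sub>1 + \<delta> *\<^sub>R u) + \<delta> *\<^sub>R T w - w\<^sub>1" by simp
    then show ?thesis unfolding step x_def[symmetric] G_def[symmetric] by (simp add: algebra_simps)
  qed
  finally have 1: "0 \<le> \<sigma> * inner (v - w\<^sub>1) (w\<^sub>1 - z)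
      + (1 - \<sigma>) * (inner (x - w\<^sub>1) (w\<^sub>1 - z) - \<delta>' * inner G (w\<^sub>1 - z))
      + \<delta> * inner (T w\<^sub>1 - T w) (w\<^sub>1 - z)"
    by (simp only: inner_add_left inner_diff_left[of "_ + _"] inner_scaleR_left) (simp add: algebra_simps)
  have three_point: "2 * inner (a - w\<^sub>1) (w\<^sub>1 - z)
      = (norm (a - z))\<^sup>2 - (norm (a - w\<^sub>1))\<^sup>2 - (norm (w\<^sub>1 - z))\<^sup>2" for a
    unfolding power2_norm_eq_inner
    by (simp add: inner_diff_left inner_diff_right inner_commute)
  have xz: "(norm (x - z))\<^sup>2
      = (1 + \<theta>) * (norm p)\<^sup>2 - \<theta> * (norm (w' - z))\<^sup>2 + \<theta> * (1 + \<theta>) * (norm q)\<^sup>2"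
  proof -
    have eq: "x - z = p + \<theta> *\<^sub>R q" "w' - z = p - q" by (simp_all add: x_def p_def q_def)
    show ?thesis unfolding eq power2_norm_eq_inner
      by (simp add: inner_diff_left inner_diff_right inner_add_left inner_add_right
          inner_commute algebra_simps)
  qed
  \<comment> \<open>The exact expansion also contains
    \<open>\<theta> * (norm (q - s))\<^sup>2\<close>, which is dropped.\<close>
  have xw: "(1 - \<theta>) * (norm s)\<^sup>2 - \<theta> * (1 - \<theta>) * (norm q)\<^sup>2 \<le> (norm (x - w\<^sub>1))\<^sup>2"
  proof -
    have eq: "x - w\<^sub>1 = \<theta> *\<^sub>R q - s" by (simp add: x_def q_def s_def)
    have "(norm (x - w\<^sub>1))\<^sup>2 = (1 - \<theta>) * (norm s)\<^sup>2 - \<theta> * (1 - \<theta>) * (norm q)\<^sup>2 + \<theta> * (norm (q - s))\<^sup>2"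
      unfolding eq power2_norm_eq_inner
      by (simp add: inner_diff_left inner_diff_right inner_commute algebra_simps)
    then show ?thesis using \<open>0 \<le> \<theta>\<close> by simp
  qed
  have Gs: "- 2 * \<delta>' * inner G s \<le> \<rho> * (norm q)\<^sup>2 + \<rho> * (norm s)\<^sup>2"
  proof -
    have "- inner G s \<le> norm G * norm s"
      using Cauchy_Schwarz_ineq2[of G s] by linarith
    then have "\<delta>' * (- inner G s) \<le> \<delta>' * (norm G * norm s)"
      using \<open>0 \<le> \<delta>'\<close> by (rule mult_left_mono)
    also have "\<dots> \<le> (\<rho> * norm q) * norm s"
      using lip unfolding G_def q_def by (simp add: mult_right_mono flip: mult.assoc)
    finally have "- 2 * \<delta>' * inner G s \<le> \<rho> * (2 * norm q * norm s)" by (simp add: algebra_simps)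
    also have "\<dots> \<le> \<rho> * ((norm q)\<^sup>2 + (norm s)\<^sup>2)"
      using \<open>0 \<le> \<rho>\<close> by (intro mult_left_mono sum_squares_bound)
    finally show ?thesis by (simp add: algebra_simps)
  qed
  have "w\<^sub>1 - z = p + s" by (simp add: p_def s_def)
  then have "inner G (w\<^sub>1 - z) = inner G p + inner G s" by (simp add: inner_add_right)
  \<comment> \<open>The contributions \<open>\<theta> * (1 + \<theta>)\<close> from
    \<open>xz\<close> and \<open>\<theta> * (1 - \<theta>)\<close> from \<open>xw\<close> add up to
    the coefficient \<open>2 * \<theta>\<close> of \<open>(norm q)\<^sup>2\<close>.\<close>
  then have "(norm (x - z))\<^sup>2 - (norm (x - w\<^sub>1))\<^sup>2 - 2 * \<delta>' * inner G (w\<^sub>1 - z)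
      \<le> (norm p)\<^sup>2 - 2 * \<delta>' * inner G p + \<theta> * ((norm p)\<^sup>2 - (norm (w' - z))\<^sup>2)
        + (2 * \<theta> + \<rho>) * (norm q)\<^sup>2 - (1 - \<theta> - \<rho>) * (norm s)\<^sup>2"
    using xz xw Gs by (simp add: algebra_simps)
  then have "(1 - \<sigma>) * ((norm (x - z))\<^sup>2 - (norm (x - w\<^sub>1))\<^sup>2 - 2 * \<delta>' * inner G (w\<^sub>1 - z))
      \<le> (1 - \<sigma>) * ((norm p)\<^sup>2 - 2 * \<delta>' * inner G p + \<theta> * ((norm p)\<^sup>2 - (norm (w' - z))\<^sup>2)
        + (2 * \<theta> + \<rho>) * (norm q)\<^sup>2 - (1 - \<theta> - \<rho>) * (norm s)\<^sup>2)"
    using \<open>\<sigma> \<le> 1\<close> by (intro mult_left_mono) auto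
  moreover have "0 \<le> \<sigma> * ((norm (v - z))\<^sup>2 - (norm (v - w\<^sub>1))\<^sup>2)
      + (1 - \<sigma>) * ((norm (x - z))\<^sup>2 - (norm (x - w\<^sub>1))\<^sup>2 - 2 * \<delta>' * inner G (w\<^sub>1 - z))
      - (norm (w\<^sub>1 - z))\<^sup>2 + 2 * \<delta> * inner (T w\<^sub>1 - T w) (w\<^sub>1 - z)"
  proof -
    have "0 \<le> 2 * (\<sigma> * inner (v - w\<^sub>1) (w\<^sub>1 - z)
      + (1 - \<sigma>) * (inner (x - w\<^sub>1) (w\<^sub>1 - z) - \<delta>' * inner G (w\<^sub>1 - z))
      + \<delta> * inner (T w\<^sub>1 - T w) (w\<^sub>1 - z))"
      using 1 by simp
    also have "\<dots> = \<sigma> * (2 * inner (v - w\<^sub>1) (w\<^sub>1 - z)) + (1 - \<sigma>) * (2 * inner (x - w\<^sub>1) (w\<^sub>1 - z))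
      - (1 - \<sigma>) * (2 * \<delta>' * inner G (w\<^sub>1 - z)) + 2 * \<delta> * inner (T w\<^sub>1 - T w) (w\<^sub>1 - z)"
      by argo
    finally show ?thesis unfolding three_point by argo
  qed
  ultimately show ?thesis unfolding p_def q_def s_def G_def by linarith
qed

text \<open>Since \<open>d * \<sigma>\<close> is dominated by \<open>d\<^sup>2\<close> and \<open>\<sigma>\<^sup>2\<close> (AM-GM), increments need not be known to tend
  to zero in advance.\<close>

lemma absorb_increments:
  fixes K \<epsilon> \<sigma> d e :: real
  assumes "\<epsilon> > 0"
  shows "\<sigma> * (2 * (K * (\<sigma> + d + e))) - \<epsilon> * (d\<^sup>2 + e\<^sup>2) \<le> \<sigma>\<^sup>2 * (2 * K + 2 * K\<^sup>2 / \<epsilon>)"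
proof -
  have amgm: "2 * K * \<sigma> * x - \<epsilon> * x\<^sup>2 \<le> \<sigma>\<^sup>2 * (K\<^sup>2 / \<epsilon>)" for x
  proof -
    have "0 \<le> (K * \<sigma> - \<epsilon> * x)\<^sup>2 / \<epsilon>" using assms by simp
    also have "\<dots> = \<sigma>\<^sup>2 * (K\<^sup>2 / \<epsilon>) - 2 * K * \<sigma> * x + \<epsilon> * x\<^sup>2"
      using assms by (simp add: field_simps power2_eq_square)
    finally show ?thesis by simp
  qed
  have "\<sigma> * (2 * (K * (\<sigma> + d + e))) = 2 * K * \<sigma>\<^sup>2 + 2 * K * \<sigma> * d + 2 * K * \<sigma> * e"
    by (simp add: algebra_simps power2_eq_square)
  moreover have "\<sigma>\<^sup>2 * (2 * K + 2 * K\<^sup>2 / \<epsilon>) = 2 * K * \<sigma>\<^sup>2 + 2 * (\<sigma>\<^sup>2 * (K\<^sup>2 / \<epsilon>))"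
    by (simp add: distrib_left)
  ultimately show ?thesis using amgm[of d] amgm[of e] by argo
qed

section \<open>Strong convergence\<close>

theorem theorem4p6:
  fixes S :: "'a::{real_inner, complete_space} \<Rightarrow> 'a set"
    and T :: "'a \<Rightarrow> 'a"
    and L \<beta> r :: real
    and \<sigma> c \<theta> \<delta> :: "nat \<Rightarrow> real"
    and v :: 'a
    and w :: "nat \<Rightarrow> 'a"
  assumes S: "maximal_monotone S"
    and T_monotone: "\<forall>a b. inner (T a - T b) (a - b) \<ge> 0"
    and L_pos: "L > 0"
    and T_lipschitz: "L-lipschitz_on UNIV T"
    and zeros: "op_inverse (op_sum S T) 0 \<noteq> {}"
    and \<delta>_init: "\<delta> 0 > 0" "\<delta> 1 > 0"
    and \<beta>: "0 < \<beta>" "\<beta> < 1 / 4"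
    and r: "\<beta> < r" "r < (1 - 2 * \<beta>) / 2"
    and \<sigma>: "\<forall>n\<ge>1. 0 < \<sigma> n \<and> \<sigma> n < 1"
    and c_nonneg: "\<forall>n\<ge>1. 0 \<le> c n"
    and c_summable: "summable (\<lambda>n. c (Suc n))"
    and w_step: "\<forall>n\<ge>1. w (n + 1) = resolvent (\<delta> n) S
          (\<sigma> n *\<^sub>R v + (1 - \<sigma> n) *\<^sub>R (w n + \<theta> n *\<^sub>R (w n - w (n - 1)))
            - \<delta> n *\<^sub>R T (w n)
            - (\<delta> (n - 1) * (1 - \<sigma> n)) *\<^sub>R (T (w n) - T (w (n - 1))))"
    and \<delta>_step: "\<forall>n\<ge>1. \<delta> (n + 1) =
          (if T (w n) \<noteq> T (w (n + 1))
           then min (r * norm (w n - w (n + 1)) / norm (T (w n) - T (w (n + 1)))) (\<delta> n + c n)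
           else \<delta> n + c n)"
    and \<theta>: "\<exists>\<theta>\<^sub>m\<^sub>a\<^sub>x::real. \<forall>n\<ge>1. 0 \<le> \<theta> n \<and> \<theta> n \<le> \<theta> (n + 1) \<and> \<theta> (n + 1) \<le> \<theta>\<^sub>m\<^sub>a\<^sub>x \<and>
          \<theta>\<^sub>m\<^sub>a\<^sub>x < min (\<beta> / 2) ((1 / 2 - r) / 2)"
    and \<sigma>_lim: "\<sigma> \<longlonglongrightarrow> 0"
    and \<sigma>_sum: "filterlim (\<lambda>N. \<Sum>n=1..N. \<sigma> n) at_top at_top"
  shows "w \<longlonglongrightarrow> metric_projection (op_inverse (op_sum S T) 0) v"
proof -

  \<comment> \<open>Inertial bound, step sizes and the limit point\<close>
  note mono = T_monotone[rule_format]
  have "r > 0" using \<beta> r by simp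
  obtain \<theta>m where \<theta>m: "\<And>n. n \<ge> 1 \<Longrightarrow> 0 \<le> \<theta> n" "\<And>n. n \<ge> 1 \<Longrightarrow> \<theta> n \<le> \<theta> (n + 1)"
    "\<And>n. n \<ge> 1 \<Longrightarrow> \<theta> n \<le> \<theta>m" "4 * \<theta>m < 1 - 2 * r"
  proof -
    obtain \<theta>m where *: "\<forall>n\<ge>1. 0 \<le> \<theta> n \<and> \<theta> n \<le> \<theta> (n + 1) \<and> \<theta> (n + 1) \<le> \<theta>m
        \<and> \<theta>m < min (\<beta> / 2) ((1 / 2 - r) / 2)"
      using \<theta> by blast
    then have "\<theta>m < (1 / 2 - r) / 2" by force
    then have "4 * \<theta>m < 1 - 2 * r" by simp
    moreover have "\<theta> n \<le> \<theta>m" if "n \<ge> 1" for n using * that by force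
    ultimately show thesis using that[of \<theta>m] * by blast
  qed
  have "0 \<le> \<theta>m" using \<theta>m(1)[of 1] \<theta>m(3)[of 1] by simp
  obtain m \<delta>l where "m > 0" and \<delta>_ge: "\<And>n. n \<ge> 1 \<Longrightarrow> m \<le> \<delta> n"
    and \<delta>_lim: "\<delta> \<longlonglongrightarrow> \<delta>l" "\<delta>l > 0"
    and T_step: "\<And>n. n \<ge> 1 \<Longrightarrow> \<delta> (Suc n) * norm (T (w (Suc n)) - T (w n)) \<le> r * norm (w (Suc n) - w n)"
    using adaptive_steps_converge[OF \<open>r > 0\<close> L_pos T_lipschitz \<delta>_init(2) c_nonneg c_summable \<delta>_step]
    by metis
  have \<delta>_pos: "\<delta> n > 0" for n
    using \<delta>_init(1) \<delta>_ge[of n] \<open>m > 0\<close> by (cases n) auto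
  have zero_iff: "z' \<in> op_inverse (op_sum S T) 0 \<longleftrightarrow> - T z' \<in> S z'" for z'
    unfolding op_inverse_def op_sum_def mem_Collect_eq by (metis add_eq_0_iff2)
  obtain z\<^sub>1 where "- T z\<^sub>1 \<in> S z\<^sub>1"
    using zeros zero_iff by blast
  then obtain z t y where z: "- T z \<in> S z"
    and var: "\<And>z'. - T z' \<in> S z' \<Longrightarrow> inner (v - z) (z' - z) \<le> 0"
    and path: "\<And>n::nat. t n > 0" "\<And>n. t n *\<^sub>R (v - y n) - T (y n) \<in> S (y n)" "y \<longlonglongrightarrow> z"
    using tikhonov_path_converges[OF S mono T_lipschitz, where v = v] by metis
  have proj: "metric_projection (op_inverse (op_sum S T) 0) v = z"
  proof (rule metric_projection_eqI)
    show "z \<in> op_inverse (op_sum S T) 0" using z zero_iff by simp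
    show "inner (v - z) (z' - z) \<le> 0" if "z' \<in> op_inverse (op_sum S T) 0" for z'
      using that zero_iff var by simp
  qed

  \<comment> \<open>The iteration as an inclusion for \<open>S\<close>\<close>
  have "\<exists>u. u \<in> S (w (Suc n)) \<and> w (Suc n) + \<delta> n *\<^sub>R u
      = \<sigma> n *\<^sub>R v + (1 - \<sigma> n) *\<^sub>R (w n + \<theta> n *\<^sub>R (w n - w (n - 1)))
        - \<delta> n *\<^sub>R T (w n) - (\<delta> (n - 1) * (1 - \<sigma> n)) *\<^sub>R (T (w n) - T (w (n - 1)))"
    if "n \<ge> 1" for n
    using resolvent_mem[OF S \<delta>_pos[of n]] w_step that by (metis Suc_eq_plus1)
  then obtain u where u: "\<And>n. n \<ge> 1 \<Longrightarrow> u n \<in> S (w (Suc n))"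
    and u_eq: "\<And>n. n \<ge> 1 \<Longrightarrow> w (Suc n) + \<delta> n *\<^sub>R u n
      = \<sigma> n *\<^sub>R v + (1 - \<sigma> n) *\<^sub>R (w n + \<theta> n *\<^sub>R (w n - w (n - 1)))
        - \<delta> n *\<^sub>R T (w n) - (\<delta> (n - 1) * (1 - \<sigma> n)) *\<^sub>R (T (w n) - T (w (n - 1)))"
    by metis

  \<comment> \<open>The Lyapunov function and the energy inequality\<close>
  define A where "A n = (norm (w n - z))\<^sup>2" for n
  define d where "d n = norm (w n - w (n - 1))" for n
  define E where "E n = 2 * \<delta> (n - 1) * inner (T (w n) - T (w (n - 1))) (w n - z)" for n
  \<comment> \<open>The step rule controls the increment of \<open>T\<close> with weight
    \<open>\<delta> n\<close>, but the iteration uses \<open>\<delta> (n - 1)\<close>. The ratio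
    converts one into the other and tends to 1.\<close>
  define \<rho> where "\<rho> n = r * (\<delta> (n - 1) / \<delta> n)" for n
  \<comment> \<open>\<kappa> is the midpoint between \<open>2 * \<theta>m + r\<close> and
    \<open>1 - \<theta>m - r\<close>, and \<open>3 * \<epsilon>\<close> is its distance to either
    end: one \<epsilon> pays for \<open>\<rho> n\<close> exceeding \<open>r\<close>, the other two
    for the descent. \<mu> is what remains of the coefficient of \<open>A n\<close> in
    \<open>A_le_a\<close>.\<close>
  define \<kappa> \<epsilon> \<mu> where "\<kappa> = (1 + \<theta>m) / 2" and "\<epsilon> = (1 - 3 * \<theta>m - 2 * r) / 6"
    and "\<mu> = 1 - r - \<epsilon> - 2 * \<theta>m"
  define a where "a n = A n - E n - \<theta> n * A (n - 1) + \<kappa> * (d n)\<^sup>2" for n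
  define b where "b n = (norm (v - z))\<^sup>2 - (norm (v - w (Suc n)))\<^sup>2" for n
  have "\<epsilon> > 0" "\<mu> > 0" "r + \<epsilon> \<le> 1"
    using \<theta>m(4) \<open>0 \<le> \<theta>m\<close> \<open>r > 0\<close> by (simp_all add: \<epsilon>_def \<mu>_def field_simps)
  have \<rho>_pos: "\<rho> n \<ge> 0" for n
    using \<delta>_pos[of n] \<delta>_pos[of "n - 1"] \<open>r > 0\<close> by (simp add: \<rho>_def)
  have T_diff: "\<delta> (n - 1) * norm (T (w n) - T (w (n - 1))) \<le> \<rho> n * d n" if "n \<ge> 2" for n
  proof -
    have "\<delta> n * norm (T (w n) - T (w (n - 1))) \<le> r * d n"
      using T_step[of "n - 1"] that by (simp add: d_def)
    then have "\<delta> (n - 1) / \<delta> n * (\<delta> n * norm (T (w n) - T (w (n - 1)))) \<le> \<delta> (n - 1) / \<delta> n * (r * d n)"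
      using \<delta>_pos by (intro mult_left_mono) (simp_all add: less_imp_le)
    moreover have "\<delta> n \<noteq> 0" using \<delta>_pos[of n] by simp
    ultimately show ?thesis by (simp add: \<rho>_def mult_ac)
  qed
  have E_bound: "\<bar>E n\<bar> \<le> \<rho> n * (A n + (d n)\<^sup>2)" if "n \<ge> 2" for n
  proof -
    have "\<bar>E n\<bar> = 2 * (\<delta> (n - 1) * \<bar>inner (T (w n) - T (w (n - 1))) (w n - z)\<bar>)"
      using \<delta>_pos[of "n - 1"] by (simp add: E_def abs_mult)
    also have "\<dots> \<le> 2 * (\<delta> (n - 1) * (norm (T (w n) - T (w (n - 1))) * norm (w n - z)))"
      using \<delta>_pos[of "n - 1"] by (intro mult_left_mono Cauchy_Schwarz_ineq2) auto
    also have "\<dots> \<le> 2 * ((\<rho> n * d n) * norm (w n - z))"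
      using T_diff[OF that] by (simp add: mult_right_mono flip: mult.assoc)
    also have "\<dots> = \<rho> n * (2 * norm (w n - z) * d n)" by simp
    also have "\<dots> \<le> \<rho> n * (A n + (d n)\<^sup>2)"
      unfolding A_def using \<rho>_pos by (intro mult_left_mono sum_squares_bound)
    finally show ?thesis .
  qed
  have energy: "A (Suc n) - E (Suc n) \<le> \<sigma> n * b n
      + (1 - \<sigma> n) * (A n - E n + \<theta> n * (A n - A (n - 1))
        + (2 * \<theta> n + \<rho> n) * (d n)\<^sup>2 - (1 - \<theta> n - \<rho> n) * (d (Suc n))\<^sup>2)" if "n \<ge> 2" for n
  proof -
    have n: "n \<ge> 1" using that by simp
    show ?thesis
      using reflected_step_energy[OF S mono \<theta>m(1)[OF n] _ _ _ \<delta>_pos[of n] \<rho>_pos[of n] z u[OF n] u_eq[OF n]]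
        T_diff[OF that] \<sigma> n \<delta>_pos[of "n - 1"]
      by (simp add: A_def E_def b_def d_def less_imp_le)
  qed

  \<comment> \<open>Descent and coercivity for large indices\<close>
  have "(\<lambda>n. r * (\<delta> n / \<delta> (Suc n))) \<longlonglongrightarrow> r * (\<delta>l / \<delta>l)"
    using \<delta>_lim by (intro tendsto_intros) (auto simp: filterlim_sequentially_Suc)
  then have "(\<lambda>n. \<rho> (Suc n)) \<longlonglongrightarrow> r" using \<delta>_lim(2) by (simp add: \<rho>_def)
  then have "\<rho> \<longlonglongrightarrow> r" by (simp add: filterlim_sequentially_Suc)
  then have "\<forall>\<^sub>F n in sequentially. \<rho> n < r + \<epsilon>"
    using \<open>\<epsilon> > 0\<close> by (intro order_tendstoD) auto
  moreover have "\<forall>\<^sub>F n in sequentially. \<sigma> n < \<epsilon>"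
    using \<sigma>_lim \<open>\<epsilon> > 0\<close> by (intro order_tendstoD) auto
  ultimately have "\<forall>\<^sub>F n in sequentially. \<rho> n < r + \<epsilon> \<and> \<sigma> n < \<epsilon> \<and> n \<ge> 2"
    using eventually_ge_at_top[of "2::nat"] by eventually_elim auto
  then obtain N where N: "\<And>n. n \<ge> N \<Longrightarrow> \<rho> n < r + \<epsilon>" "\<And>n. n \<ge> N \<Longrightarrow> \<sigma> n < \<epsilon>" "\<And>n. n \<ge> N \<Longrightarrow> n \<ge> 2"
    unfolding eventually_sequentially by metis
  have \<sigma>_N: "0 < \<sigma> n" "\<sigma> n < 1" "\<sigma> n \<le> 1 / 2" if "n \<ge> N" for n
  proof -
    show "0 < \<sigma> n" "\<sigma> n < 1" using \<sigma> N(3)[OF that] by auto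
    have "\<epsilon> \<le> 1 / 2" using \<open>0 \<le> \<theta>m\<close> \<open>r > 0\<close> by (simp add: \<epsilon>_def)
    then show "\<sigma> n \<le> 1 / 2" using N(2)[OF that] by simp
  qed
  \<comment> \<open>Fact 1 uses that \<theta> is nondecreasing, so the inertial terms telescope.
    Fact 2 loses half of \<open>2 * \<epsilon>\<close> because
    \<open>\<sigma> n \<le> 1 / 2\<close>. Fact 3 loses one \<epsilon> because
    \<open>\<sigma> n < \<epsilon>\<close> and
    \<open>\<kappa> + 2 * \<epsilon> \<le> 1\<close>.\<close>
  have descent: "a (Suc n) \<le> (1 - \<sigma> n) * a n + \<sigma> n * b n - \<epsilon> * ((d n)\<^sup>2 + (d (Suc n))\<^sup>2)"
    if "n \<ge> N" for n
  proof -
    have n: "n \<ge> 1" "n \<ge> 2" using N(3)[OF that] by auto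
    note s = \<sigma>_N[OF that]
    have A: "0 \<le> A n" by (simp add: A_def)
    have "(1 - \<sigma> n) * (\<theta> n * A n) \<le> 1 * (\<theta> n * A n)"
      using s \<theta>m(1)[OF n(1)] A by (intro mult_right_mono mult_nonneg_nonneg) auto
    also have "\<dots> \<le> \<theta> (Suc n) * A n"
      using \<theta>m(2)[OF n(1)] A by (simp add: mult_right_mono)
    finally have 1: "(1 - \<sigma> n) * (\<theta> n * A n) \<le> \<theta> (Suc n) * A n" .
    have "2 * \<theta> n + \<rho> n \<le> \<kappa> - 2 * \<epsilon>"
      using \<theta>m(3)[OF n(1)] N(1)[OF that] unfolding \<kappa>_def \<epsilon>_def by argo
    then have "(1 - \<sigma> n) * (2 * \<theta> n + \<rho> n) \<le> (1 - \<sigma> n) * (\<kappa> - 2 * \<epsilon>)"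
      using s by (intro mult_left_mono) auto
    also have "\<dots> \<le> (1 - \<sigma> n) * \<kappa> - \<epsilon>"
      using s mult_right_mono[OF s(3), of "2 * \<epsilon>"] \<open>\<epsilon> > 0\<close> by (simp add: algebra_simps)
    finally have "(1 - \<sigma> n) * (2 * \<theta> n + \<rho> n) * (d n)\<^sup>2 \<le> ((1 - \<sigma> n) * \<kappa> - \<epsilon>) * (d n)\<^sup>2"
      by (rule mult_right_mono) simp
    then have 2: "(1 - \<sigma> n) * ((2 * \<theta> n + \<rho> n) * (d n)\<^sup>2) \<le> (1 - \<sigma> n) * (\<kappa> * (d n)\<^sup>2) - \<epsilon> * (d n)\<^sup>2"
      by (simp add: left_diff_distrib mult.assoc)
    have "\<kappa> + 2 * \<epsilon> \<le> 1 - \<theta> n - \<rho> n"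
      using \<theta>m(3)[OF n(1)] N(1)[OF that] unfolding \<kappa>_def \<epsilon>_def by argo
    then have "(1 - \<sigma> n) * (\<kappa> + 2 * \<epsilon>) \<le> (1 - \<sigma> n) * (1 - \<theta> n - \<rho> n)"
      using s by (intro mult_left_mono) auto
    moreover have "\<kappa> + 2 * \<epsilon> \<le> 1"
      using \<open>0 \<le> \<theta>m\<close> \<open>r > 0\<close> unfolding \<kappa>_def \<epsilon>_def by argo
    then have "\<sigma> n * (\<kappa> + 2 * \<epsilon>) \<le> \<sigma> n * 1" using s by (intro mult_left_mono) auto
    then have "\<kappa> + \<epsilon> \<le> (1 - \<sigma> n) * (\<kappa> + 2 * \<epsilon>)" using N(2)[OF that] by (simp add: left_diff_distrib)
    ultimately have "(\<kappa> + \<epsilon>) * (d (Suc n))\<^sup>2 \<le> (1 - \<sigma> n) * (1 - \<theta> n - \<rho> n) * (d (Suc n))\<^sup>2"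
      by (intro mult_right_mono) auto
    then have 3: "\<kappa> * (d (Suc n))\<^sup>2 + \<epsilon> * (d (Suc n))\<^sup>2 \<le> (1 - \<sigma> n) * ((1 - \<theta> n - \<rho> n) * (d (Suc n))\<^sup>2)"
      by (simp add: distrib_right mult.assoc)
    have "(1 - \<sigma> n) * (A n - E n + \<theta> n * (A n - A (n - 1))
          + (2 * \<theta> n + \<rho> n) * (d n)\<^sup>2 - (1 - \<theta> n - \<rho> n) * (d (Suc n))\<^sup>2)
        = (1 - \<sigma> n) * (A n - E n - \<theta> n * A (n - 1)) + (1 - \<sigma> n) * (\<theta> n * A n)
          + (1 - \<sigma> n) * ((2 * \<theta> n + \<rho> n) * (d n)\<^sup>2) - (1 - \<sigma> n) * ((1 - \<theta> n - \<rho> n) * (d (Suc n))\<^sup>2)"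
      by (simp only: distrib_left right_diff_distrib)
    moreover have "(1 - \<sigma> n) * a n
        = (1 - \<sigma> n) * (A n - E n - \<theta> n * A (n - 1)) + (1 - \<sigma> n) * (\<kappa> * (d n)\<^sup>2)"
      by (simp only: a_def distrib_left)
    moreover have "a (Suc n) = A (Suc n) - E (Suc n) - \<theta> (Suc n) * A n + \<kappa> * (d (Suc n))\<^sup>2"
      by (simp add: a_def)
    ultimately show ?thesis
      using energy[OF n(2)] 1 2 3 by (simp only: distrib_left)
  qed
  \<comment> \<open>Both negative parts of \<open>a n\<close> are bounded by \<open>A n\<close> and
    \<open>(d n)\<^sup>2\<close>, using \<open>A (n - 1) \<le> 2 * A n + 2 * (d n)\<^sup>2\<close>.
    The coefficient \<kappa> covers all the squared increments with \<open>2 * \<epsilon>\<close> to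
    spare.\<close>
  have A_le_a: "\<mu> * A n \<le> a n" if "n \<ge> N" for n
  proof -
    have n: "n \<ge> 1" "n \<ge> 2" using N(3)[OF that] by auto
    have nn: "0 \<le> A n" "0 \<le> A (n - 1)" "0 \<le> (d n)\<^sup>2" by (simp_all add: A_def)
    have "norm (w (n - 1) - z) \<le> norm (w n - z) + d n"
      using norm_triangle_ineq4[of "w n - z" "w n - w (n - 1)"] by (simp add: d_def)
    then have "A (n - 1) \<le> (norm (w n - z) + d n)\<^sup>2"
      unfolding A_def by (intro power_mono) auto
    also have "\<dots> \<le> 2 * A n + 2 * (d n)\<^sup>2"
      using sum_squares_bound[of "norm (w n - z)" "d n"] by (simp add: A_def power2_sum)
    finally have "\<theta>m * A (n - 1) \<le> \<theta>m * (2 * A n + 2 * (d n)\<^sup>2)"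
      using \<open>0 \<le> \<theta>m\<close> by (rule mult_left_mono)
    moreover have "\<theta> n * A (n - 1) \<le> \<theta>m * A (n - 1)"
      using \<theta>m(3)[OF n(1)] nn by (intro mult_right_mono) auto
    moreover have "\<rho> n * (A n + (d n)\<^sup>2) \<le> (r + \<epsilon>) * (A n + (d n)\<^sup>2)"
      using N(1)[OF that] nn by (intro mult_right_mono) auto
    moreover have "\<kappa> = r + \<epsilon> + 2 * \<theta>m + 2 * \<epsilon>" unfolding \<kappa>_def \<epsilon>_def by argo
    then have "\<kappa> * (d n)\<^sup>2 = (r + \<epsilon>) * (d n)\<^sup>2 + \<theta>m * (2 * (d n)\<^sup>2) + 2 * \<epsilon> * (d n)\<^sup>2"
      by (simp add: algebra_simps)
    moreover have "0 \<le> 2 * \<epsilon> * (d n)\<^sup>2" using \<open>\<epsilon> > 0\<close> by simp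
    moreover have "\<mu> * A n = A n - (r + \<epsilon>) * A n - \<theta>m * (2 * A n)"
      by (simp add: \<mu>_def algebra_simps)
    ultimately show ?thesis
      using E_bound[OF n(2)] unfolding a_def distrib_left by linarith
  qed
  have A_nonneg: "0 \<le> A n" for n by (simp add: A_def)
  have a_nonneg: "0 \<le> a n" if "n \<ge> N" for n
    using A_le_a[OF that] mult_nonneg_nonneg[of \<mu> "A n"] \<open>\<mu> > 0\<close> A_nonneg[of n] by linarith

  \<comment> \<open>Boundedness of the iterates and size of the residuals\<close>
  define Ba where "Ba = max (a N) ((norm (v - z))\<^sup>2)"
  have a_bounded: "a n \<le> Ba" if "n \<ge> N" for n
    using that
  proof (induction n rule: dec_induct)
    case (step n)
    \<comment> \<open>Dropping the negative square in \<open>b n\<close> leaves at most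
      \<open>(norm (v - z))\<^sup>2\<close>, so \<open>descent\<close> bounds
      \<open>a (Suc n)\<close> by a convex combination of numbers not exceeding
      \<open>Ba\<close>.\<close>
    have "b n \<le> Ba" by (simp add: b_def Ba_def le_max_iff_disj)
    then have "\<sigma> n * b n \<le> \<sigma> n * Ba" "(1 - \<sigma> n) * a n \<le> (1 - \<sigma> n) * Ba"
      using \<sigma>_N[OF step(1)] step by (simp_all add: mult_left_mono)
    moreover have "\<sigma> n * Ba + (1 - \<sigma> n) * Ba = Ba" by (simp add: algebra_simps)
    moreover have "0 \<le> \<epsilon> * ((d n)\<^sup>2 + (d (Suc n))\<^sup>2)" using \<open>\<epsilon> > 0\<close> by simp
    ultimately show ?case using descent[OF step(1)] by linarith
  qed (simp add: Ba_def)
  define M where "M = sqrt (Ba / \<mu>)"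
  have w_bounded: "norm (w n - z) \<le> M" if "n \<ge> N" for n
  proof -
    have "\<mu> * A n \<le> Ba" using A_le_a[OF that] a_bounded[OF that] by linarith
    then have "A n \<le> Ba / \<mu>" using \<open>\<mu> > 0\<close> by (simp add: field_simps)
    then show ?thesis unfolding M_def A_def by (rule real_le_rsqrt)
  qed
  have "M \<ge> 0" using w_bounded[of N] norm_ge_zero[of "w N - z"] by linarith
  \<comment> \<open>The residual \<open>u n + T (w (Suc n))\<close> lies in the image of
    \<open>w (Suc n)\<close> under S + T. Multiplied by \<open>\<delta> n \<ge> m\<close>, it splits
    into terms totalling at most three copies of \<open>d n\<close>, two of
    \<open>d (Suc n)\<close>, and the anchor term with factor \<open>\<sigma> n\<close>.\<close>
  define C where "C = (norm (v - z) + M + 3) / m"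
  have "C \<ge> 0" using \<open>M \<ge> 0\<close> \<open>m > 0\<close> by (simp add: C_def)
  have residual: "norm (u n + T (w (Suc n))) \<le> C * (\<sigma> n + d n + d (Suc n))" if "n \<ge> N" for n
  proof -
    have n: "n \<ge> 1" "n \<ge> 2" using N(3)[OF that] by auto
    note s = \<sigma>_N[OF that]
    define x where "x = w n + \<theta> n *\<^sub>R (w n - w (n - 1))"
    define e\<^sub>1 e\<^sub>2 where "e\<^sub>1 = \<delta> n *\<^sub>R (T (w (Suc n)) - T (w n))"
      and "e\<^sub>2 = (\<delta> (n - 1) * (1 - \<sigma> n)) *\<^sub>R (T (w n) - T (w (n - 1)))"
    have dn: "0 \<le> d n" "0 \<le> d (Suc n)" by (simp_all add: d_def)
    have "\<theta> n \<le> 1"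
      using \<theta>m(3)[OF n(1)] \<theta>m(4) \<open>r > 0\<close> by linarith
    then have \<theta>d: "\<theta> n * d n \<le> d n"
      using mult_right_mono[of "\<theta> n" 1 "d n"] dn by simp
    have "\<rho> k * d k \<le> d k" if "k \<ge> N" for k
      using mult_right_mono[of "\<rho> k" 1 "d k"] N(1)[OF that] \<open>r + \<epsilon> \<le> 1\<close> by (simp add: d_def)
    then have \<rho>d: "\<rho> n * d n \<le> d n" "\<rho> (Suc n) * d (Suc n) \<le> d (Suc n)"
      using that by simp_all
    have "norm (v - x) \<le> norm (v - z) + norm (w n - z) + norm (\<theta> n *\<^sub>R (w n - w (n - 1)))"
    proof -
      have eq: "v - x = (v - z) - (w n - z) - \<theta> n *\<^sub>R (w n - w (n - 1))" by (simp add: x_def)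
      show ?thesis
        unfolding eq using norm_triangle_ineq4[of "(v - z) - (w n - z)" "\<theta> n *\<^sub>R (w n - w (n - 1))"]
          norm_triangle_ineq4[of "v - z" "w n - z"] by linarith
    qed
    moreover have \<theta>d': "norm (\<theta> n *\<^sub>R (w n - w (n - 1))) \<le> d n"
      using \<theta>d \<theta>m(1)[OF n(1)] by (simp add: d_def)
    ultimately have "norm (v - x) \<le> norm (v - z) + M + d n"
      using w_bounded[OF that] by linarith
    then have "\<sigma> n * norm (v - x) \<le> \<sigma> n * (norm (v - z) + M + d n)"
      using s by (intro mult_left_mono) auto
    also have "\<dots> \<le> \<sigma> n * (norm (v - z) + M) + d n"
      using s mult_right_mono[of "\<sigma> n" 1 "d n"] dn by (simp add: distrib_left)
    finally have 1: "norm (\<sigma> n *\<^sub>R (v - x)) \<le> \<sigma> n * (norm (v - z) + M) + d n"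
      using s by simp
    have 2: "norm e\<^sub>1 \<le> d (Suc n)"
      using T_diff[of "Suc n"] n \<rho>d(2) \<delta>_pos[of n] by (simp add: e\<^sub>1_def)
    have "norm e\<^sub>2 = (1 - \<sigma> n) * (\<delta> (n - 1) * norm (T (w n) - T (w (n - 1))))"
      using s \<delta>_pos[of "n - 1"] by (simp add: e\<^sub>2_def abs_mult)
    also have "\<dots> \<le> 1 * (\<delta> (n - 1) * norm (T (w n) - T (w (n - 1))))"
      using s \<delta>_pos[of "n - 1"] by (intro mult_right_mono) auto
    finally have 3: "norm e\<^sub>2 \<le> d n" using T_diff[OF n(2)] \<rho>d(1) by simp
    have 4: "norm (w n - w (Suc n)) = d (Suc n)" by (simp add: d_def norm_minus_commute)
    have "\<delta> n *\<^sub>R (u n + T (w (Suc n)))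
        = (w (Suc n) + \<delta> n *\<^sub>R u n) - w (Suc n) + \<delta> n *\<^sub>R T (w (Suc n))"
      by (simp add: algebra_simps)
    then have "\<delta> n *\<^sub>R (u n + T (w (Suc n)))
        = \<sigma> n *\<^sub>R (v - x) + \<theta> n *\<^sub>R (w n - w (n - 1)) + (w n - w (Suc n)) + e\<^sub>1 - e\<^sub>2"
      unfolding u_eq[OF n(1)] x_def e\<^sub>1_def e\<^sub>2_def by (simp add: algebra_simps)
    moreover have "norm (p + q + s + e - f) \<le> norm p + norm q + norm s + norm e + norm f"
      for p q s e f :: 'a
      by norm
    ultimately have "norm (\<delta> n *\<^sub>R (u n + T (w (Suc n)))) \<le> norm (\<sigma> n *\<^sub>R (v - x))
        + norm (\<theta> n *\<^sub>R (w n - w (n - 1))) + norm (w n - w (Suc n)) + norm e\<^sub>1 + norm e\<^sub>2"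
      by (simp only:)
    then have "\<delta> n * norm (u n + T (w (Suc n))) \<le> \<sigma> n * (norm (v - z) + M) + 3 * d n + 2 * d (Suc n)"
      using 1 2 3 4 \<theta>d' \<delta>_pos[of n] by simp
    also have "\<dots> \<le> (norm (v - z) + M + 3) * (\<sigma> n + d n + d (Suc n))"
    proof -
      have "0 \<le> (norm (v - z) + M) * (d n + d (Suc n))" using \<open>M \<ge> 0\<close> dn by simp
      then show ?thesis using s dn by (simp add: algebra_simps)
    qed
    finally have "m * norm (u n + T (w (Suc n))) \<le> (norm (v - z) + M + 3) * (\<sigma> n + d n + d (Suc n))"
      using mult_right_mono[OF \<delta>_ge[OF n(1)] norm_ge_zero[of "u n + T (w (Suc n))"]] by linarith
    then show ?thesis using \<open>m > 0\<close> by (simp add: C_def field_simps)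
  qed

  \<comment> \<open>Convergence of the Lyapunov function and of the iterates\<close>
  have "a \<longlonglongrightarrow> 0"
  proof (rule recursive_inequality_tendsto_0)
    show "\<forall>\<^sub>F n in sequentially. 0 \<le> a n"
      using a_nonneg unfolding eventually_sequentially by blast
    show "0 < \<sigma> n \<and> \<sigma> n < 1" if "n \<ge> 1" for n using \<sigma> that by blast
    show "filterlim (\<lambda>N. \<Sum>n=1..N. \<sigma> n) at_top at_top" by (rule \<sigma>_sum)
    fix \<eta> :: real assume "\<eta> > 0"
    \<comment> \<open>The inner product enters \<open>b n\<close> twice, so a quarter here costs
      \<open>\<eta> / 2\<close>; the other half is reserved for the quadratic term in
      \<open>\<sigma> n\<close>.\<close>
    then have "\<eta> / 4 > 0" by simp
    then obtain K where "K \<ge> 0" and K: "\<And>p q. q - T p \<in> S p \<Longrightarrow> norm (p - z) \<le> M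
        \<Longrightarrow> inner (v - z) (p - z) \<le> \<eta> / 4 + K * norm q"
      using approximate_zeros_variational[OF S mono path, where M = M] by metis
    define K' where "K' = K * C"
    have "(\<lambda>n. \<sigma> n * (2 * K' + 2 * K'\<^sup>2 / \<epsilon>)) \<longlonglongrightarrow> 0 * (2 * K' + 2 * K'\<^sup>2 / \<epsilon>)"
      by (intro tendsto_intros \<sigma>_lim)
    then have "\<forall>\<^sub>F n in sequentially. \<sigma> n * (2 * K' + 2 * K'\<^sup>2 / \<epsilon>) < \<eta> / 2"
      using \<open>\<eta> > 0\<close> by (intro order_tendstoD) auto
    then show "\<forall>\<^sub>F n in sequentially. a (Suc n) \<le> (1 - \<sigma> n) * a n + \<sigma> n * \<eta>"
      using eventually_ge_at_top[of N]
    proof eventually_elim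
      case (elim n)
      note s = \<sigma>_N[OF elim(2)]
      have "b n = 2 * inner (v - z) (w (Suc n) - z) - A (Suc n)"
        unfolding b_def A_def power2_norm_eq_inner
        by (simp add: inner_diff_left inner_diff_right inner_commute)
      moreover have "inner (v - z) (w (Suc n) - z) \<le> \<eta> / 4 + K * norm (u n + T (w (Suc n)))"
        using u[of n] N(3)[OF elim(2)] w_bounded[of "Suc n"] elim(2) by (intro K) auto
      moreover have "K * norm (u n + T (w (Suc n))) \<le> K' * (\<sigma> n + d n + d (Suc n))"
        using mult_left_mono[OF residual[OF elim(2)] \<open>K \<ge> 0\<close>] by (simp add: K'_def)
      ultimately have "b n \<le> \<eta> / 2 + 2 * (K' * (\<sigma> n + d n + d (Suc n)))"
        using A_nonneg[of "Suc n"] by linarith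
      then have "\<sigma> n * b n \<le> \<sigma> n * (\<eta> / 2 + 2 * (K' * (\<sigma> n + d n + d (Suc n))))"
        using s by (intro mult_left_mono) auto
      then have "\<sigma> n * b n - \<epsilon> * ((d n)\<^sup>2 + (d (Suc n))\<^sup>2)
          \<le> \<sigma> n * (\<eta> / 2) + (\<sigma> n)\<^sup>2 * (2 * K' + 2 * K'\<^sup>2 / \<epsilon>)"
        using absorb_increments[OF \<open>\<epsilon> > 0\<close>, of "\<sigma> n" K' "d n" "d (Suc n)"]
        unfolding distrib_left[of "\<sigma> n"] by linarith
      \<comment> \<open>One factor \<open>\<sigma> n\<close> is kept, and the other makes the
        bracket small because \<sigma> tends to 0.\<close>
      moreover have "(\<sigma> n)\<^sup>2 * (2 * K' + 2 * K'\<^sup>2 / \<epsilon>) \<le> \<sigma> n * (\<eta> / 2)"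
        using mult_left_mono[OF less_imp_le[OF elim(1)], of "\<sigma> n"] s
        by (simp only: power2_eq_square mult.assoc less_imp_le)
      ultimately show ?case using descent[OF elim(2)] by argo
    qed
  qed
  then have "(\<lambda>n. a n / \<mu>) \<longlonglongrightarrow> 0" by (rule tendsto_divide_zero)
  moreover have "\<forall>\<^sub>F n in sequentially. norm (A n) \<le> a n / \<mu>"
    using eventually_ge_at_top[of N]
  proof eventually_elim
    case (elim n)
    then show ?case using A_le_a[of n] A_nonneg[of n] \<open>\<mu> > 0\<close> by (simp add: field_simps)
  qed
  ultimately have "A \<longlonglongrightarrow> 0" by (rule Lim_null_comparison[rotated])
  then have "(\<lambda>n. sqrt (A n)) \<longlonglongrightarrow> sqrt 0" by (intro tendsto_intros)
  then have "(\<lambda>n. dist (w n) z) \<longlonglongrightarrow> 0" by (simp add: A_def dist_norm)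
  then show ?thesis unfolding proj by (rule tendsto_dist_iff[THEN iffD2])
qed

end
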